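(* Let $\mathcal{C}$ be a $d$-uniform chordal clutter on vertex set $V=\{x_1,\dots,x_n\}$, and let $\overline{\mathcal{C}}$ be its complement $d$-uniform clutter, i.e. the clutter on $V$ whose circuits are the $d$-subsets of $V$ that are not circuits of $\mathcal{C}$. Then the circuit ideal of $\overline{\mathcal{C}}$ in the polynomial ring $k[x_1,\dots,x_n]$ ($k$ a field) has a linear resolution.
   Context: A clutter on a finite vertex set $V$ is a set of subsets of $V$ (circuits) none properly containing another; it is $d$-uniform if all circuits have exactly $d$ elements. Deletion $\mathcal{C}\setminus v$: the clutter on $V\setminus\{v\}$ with the circuits not containing $v$. Contraction $\mathcal{C}/v$: the clutter on $V\setminus\{v\}$ whose circuits are the inclusion-minimal sets among $\{e\setminus\{v\}: e\text{ a circuit}\}$. A minor is obtained by a (possibly empty) sequence of deletions and contractions. A vertex $v$ is simplicial if for every two circuits $e_1,e_2$ containing $v$ there is a circuit $e_3\subseteq(e_1\cup e_2)\setminus\{v\}$. A clutter is chordal if every minor of it (having at least one vertex) has a simplicial vertex. The circuit ideal of a clutter $\mathcal{D}$ on $\{x_1,\dots,x_n\}$ is the ideal generated by the monomials $\prod_{x\in e}x$ over all circuits $e$ of $\mathcal{D}$. A homogeneous ideal generated in degree $d$ has a linear resolution if its minimal graded free resolution has all maps after the first given by matrices of linear forms (equivalently, the $i$-th syzygy module is generated in degree $d+i$ for all $i$). *)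

theory Defs
  imports "Jordan_Normal_Form.Matrix" "HOL-Algebra.Ideal" "HOL-Library.Poly_Mapping"
begin

section \<open>Clutters\<close>

definition clutter :: "'a set \<Rightarrow> 'a set set \<Rightarrow> bool" where
  "clutter V C \<longleftrightarrow> finite V \<and> (\<forall>e\<in>C. e \<subseteq> V) \<and> (\<forall>e\<in>C. \<forall>f\<in>C. \<not> e \<subset> f)"

definition uniform :: "nat \<Rightarrow> 'a set set \<Rightarrow> bool" where
  "uniform d C \<longleftrightarrow> (\<forall>e\<in>C. card e = d)"

text \<open>Circuits of the deletion and of the contraction; the vertex set of both is \<open>V - {v}\<close>.\<close>

definition deletion :: "'a set set \<Rightarrow> 'a \<Rightarrow> 'a set set" where
  "deletion C v = {e \<in> C. v \<notin> e}"

definition minimal_sets :: "'a set set \<Rightarrow> 'a set set" where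
  "minimal_sets F = {e \<in> F. \<forall>f\<in>F. \<not> f \<subset> e}"

definition contraction :: "'a set set \<Rightarrow> 'a \<Rightarrow> 'a set set" where
  "contraction C v = minimal_sets {e - {v} | e. e \<in> C}"

inductive minor :: "'a set \<Rightarrow> 'a set set \<Rightarrow> 'a set \<Rightarrow> 'a set set \<Rightarrow> bool"
  for V :: "'a set" and C :: "'a set set" where
  minor_refl: "minor V C V C"
| minor_deletion: "minor V C W D \<Longrightarrow> v \<in> W \<Longrightarrow> minor V C (W - {v}) (deletion D v)"
| minor_contraction: "minor V C W D \<Longrightarrow> v \<in> W \<Longrightarrow> minor V C (W - {v}) (contraction D v)"

text \<open>The two circuits are distinct: for \<open>e1 = e2\<close> the condition would ask for a circuit properly
  contained in \<open>e1\<close>, which no clutter has.\<close>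

definition simplicial_vertex :: "'a set \<Rightarrow> 'a set set \<Rightarrow> 'a \<Rightarrow> bool" where
  "simplicial_vertex V C v \<longleftrightarrow> v \<in> V \<and>
     (\<forall>e1\<in>C. \<forall>e2\<in>C. v \<in> e1 \<longrightarrow> v \<in> e2 \<longrightarrow> e1 \<noteq> e2 \<longrightarrow>
        (\<exists>e3\<in>C. e3 \<subseteq> (e1 \<union> e2) - {v}))"

definition chordal :: "'a set \<Rightarrow> 'a set set \<Rightarrow> bool" where
  "chordal V C \<longleftrightarrow> (\<forall>W D. minor V C W D \<longrightarrow> W \<noteq> {} \<longrightarrow> (\<exists>v. simplicial_vertex W D v))"

definition complement_clutter :: "nat \<Rightarrow> 'a set \<Rightarrow> 'a set set \<Rightarrow> 'a set set" where
  "complement_clutter d V C = {e. e \<subseteq> V \<and> card e = d \<and> e \<notin> C}"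

section \<open>Polynomials\<close>

text \<open>A polynomial with coefficients in \<open>'k\<close> and variables in \<open>'a\<close> maps exponent vectors
  to coefficients, both finitely supported.  The ring of those polynomials
  that involve only variables from \<open>V\<close> is a subring of this type.\<close>

type_synonym ('a, 'k) mpoly = "('a \<Rightarrow>\<^sub>0 nat) \<Rightarrow>\<^sub>0 'k"

definition mvar :: "'a \<Rightarrow> ('a, 'k::comm_ring_1) mpoly" where
  "mvar x = Poly_Mapping.single (Poly_Mapping.single x 1) 1"

definition polynomials_in :: "'a set \<Rightarrow> ('a, 'k::comm_ring_1) mpoly set" where
  "polynomials_in V = {p. \<forall>m\<in>Poly_Mapping.keys p. Poly_Mapping.keys m \<subseteq> V}"

definition polynomial_ring :: "'a set \<Rightarrow> ('a, 'k::comm_ring_1) mpoly ring" where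
  "polynomial_ring V =
     \<lparr>carrier = polynomials_in V, monoid.mult = (*), one = 1, zero = 0, add = (+)\<rparr>"

definition mon_degree :: "('a \<Rightarrow>\<^sub>0 nat) \<Rightarrow> nat" where
  "mon_degree m = (\<Sum>x\<in>Poly_Mapping.keys m. Poly_Mapping.lookup m x)"

definition homogeneous :: "nat \<Rightarrow> ('a, 'k::comm_ring_1) mpoly \<Rightarrow> bool" where
  "homogeneous j p \<longleftrightarrow> (\<forall>m\<in>Poly_Mapping.keys p. mon_degree m = j)"

definition circuit_ideal :: "'a set \<Rightarrow> 'a set set \<Rightarrow> ('a, 'k::field) mpoly set" where
  "circuit_ideal V D = genideal (polynomial_ring V) {\<Prod>x\<in>e. mvar x | e. e \<in> D}"

definition generated_in_degree :: "'a set \<Rightarrow> nat \<Rightarrow> ('a, 'k::field) mpoly set \<Rightarrow> bool" where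
  "generated_in_degree V d I \<longleftrightarrow>
     (\<exists>G \<subseteq> polynomials_in V. (\<forall>g\<in>G. homogeneous d g) \<and> I = genideal (polynomial_ring V) G)"

section \<open>Graded free resolutions\<close>

definition free_module :: "'a set \<Rightarrow> nat \<Rightarrow> ('a, 'k::comm_ring_1) mpoly vec set" where
  "free_module V n = {w \<in> carrier_vec n. \<forall>j<n. w $ j \<in> polynomials_in V}"

text \<open>With \<open>S\<close> the polynomial ring in the variables \<open>V\<close>, a graded free resolution of \<open>I\<close> is given by
  lists \<open>a i\<close> of natural numbers, standing for \<open>F i = (\<Oplus>j. S(- a i ! j))\<close>, and matrices \<open>M i\<close>:
  \<open>M 0\<close> is the map from \<open>F 0\<close> to \<open>S\<close> with image \<open>I\<close>, and \<open>M (Suc i)\<close> is the map from \<open>F (Suc i)\<close>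
  to \<open>F i\<close>.  Natural numbers suffice as degrees of the basis elements in a minimal resolution
  of an ideal.  The list \<open>target_degrees a i\<close> describes the target of \<open>M i\<close>.\<close>

definition target_degrees :: "(nat \<Rightarrow> nat list) \<Rightarrow> nat \<Rightarrow> nat list" where
  "target_degrees a i = (case i of 0 \<Rightarrow> [0] | Suc j \<Rightarrow> a j)"

definition graded_free_resolution ::
  "'a set \<Rightarrow> ('a, 'k::field) mpoly set \<Rightarrow> (nat \<Rightarrow> nat list) \<Rightarrow> (nat \<Rightarrow> ('a, 'k) mpoly mat) \<Rightarrow> bool"
where
  "graded_free_resolution V I a M \<longleftrightarrow>
     (\<forall>i. M i \<in> carrier_mat (length (target_degrees a i)) (length (a i))) \<and>
     (\<forall>i. elements_mat (M i) \<subseteq> polynomials_in V) \<and>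
     (\<forall>i. \<forall>r < length (target_degrees a i). \<forall>c < length (a i).
        \<forall>m \<in> Poly_Mapping.keys (M i $$ (r, c)).
          mon_degree m + target_degrees a i ! r = a i ! c) \<and>
     {(M 0 *\<^sub>v w) $ 0 | w. w \<in> free_module V (length (a 0))} = I \<and>
     (\<forall>i. {w \<in> free_module V (length (a i)). M i *\<^sub>v w = 0\<^sub>v (length (target_degrees a i))} =
           (\<lambda>w. M (Suc i) *\<^sub>v w) ` free_module V (length (a (Suc i))))"

text \<open>Minimality: the image of \<open>F (Suc i)\<close> lies in \<open>\<mm> F i\<close> for the maximal ideal \<open>\<mm>\<close> generated by
  the variables, i.e. no entry of \<open>M (Suc i)\<close> has a constant term.\<close>

definition minimal_graded_free_resolution ::
  "'a set \<Rightarrow> ('a, 'k::field) mpoly set \<Rightarrow> (nat \<Rightarrow> nat list) \<Rightarrow> (nat \<Rightarrow> ('a, 'k) mpoly mat) \<Rightarrow> bool"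
where
  "minimal_graded_free_resolution V I a M \<longleftrightarrow>
     graded_free_resolution V I a M \<and>
     (\<forall>i. \<forall>p \<in> elements_mat (M (Suc i)). Poly_Mapping.lookup p 0 = 0)"

text \<open>The minimal graded free resolution exists and is unique up to isomorphism of graded complexes,
  and linearity of the maps is invariant under such isomorphisms.\<close>

definition linear_resolution :: "'a set \<Rightarrow> nat \<Rightarrow> ('a, 'k::field) mpoly set \<Rightarrow> bool" where
  "linear_resolution V d I \<longleftrightarrow>
     generated_in_degree V d I \<and>
     (\<exists>a M. minimal_graded_free_resolution V I a M \<and>
        (\<forall>i. \<forall>p \<in> elements_mat (M (Suc i)). homogeneous 1 p))"

end

(* Eliminate a simplicial vertex v: the ideal I of the complement is x_v J + K, where J and K belong
   to the contraction and the deletion of v, and simpliciality gives K <= J unless J = 0.  Since no generator of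
   J or K involves x_v, the ideals x_v J and K meet in x_v K, so linear resolutions of J
   (generated in degree d - 1) and K (generated in degree d) combine to one of I.  No base change
   to fewer variables is needed, since all ideals are taken in the polynomial ring over V. *)

theory Submission
  imports Defs
begin

section \<open>Polynomials\<close>

text \<open>With x = x_v, the underlying exact sequence maps x K into the direct sum of x J and K,
  with quotient I. Generators of x K have degree d + 1, one above those of x J and of K, so a
  mapping cone would be linear; but it needs lifts of maps to whole resolutions. Instead, let the
  matrices M and N generate J and K, and project the syzygies of the block matrix [x M, N] to the
  N-coordinates. The kernel is Syz M. The image consists of all w with N w in x J; by K <= J and
  cancellation of x modulo K it is x F + Syz K, where F is the free module on the generators of K.
  Both are linear, and an extension of linear modules is linear by a horseshoe argument on graded
  submodules. Degrees are counted relative to the basis of each free module, so all syzygy modules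
  in the recursion are generated in degree 1; minimality is then automatic, since linear forms have
  no constant term.\<close>

lemma mon_degree_alt:
  assumes "finite S" "Poly_Mapping.keys m \<subseteq> S"
  shows "mon_degree m = (\<Sum>x\<in>S. Poly_Mapping.lookup m x)"
  unfolding mon_degree_def
  by (rule sum.mono_neutral_left) (use assms in \<open>auto simp: in_keys_iff\<close>)

text \<open>Natural number exponents cannot cancel. Hence divisibility by a squarefree monomial can
  be read off from supports.\<close>

lemma keys_add_nat:
  "Poly_Mapping.keys (m + n) = Poly_Mapping.keys m \<union> Poly_Mapping.keys n"
  for m n :: "'a \<Rightarrow>\<^sub>0 nat"
  by (auto simp: in_keys_iff lookup_add)

lemma mon_degree_add [simp]: "mon_degree (m + n) = mon_degree m + mon_degree n"
proof -
  let ?S = "Poly_Mapping.keys m \<union> Poly_Mapping.keys n"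
  have "mon_degree l = (\<Sum>x\<in>?S. Poly_Mapping.lookup l x)" if "l \<in> {m, n, m + n}" for l
    by (rule mon_degree_alt) (use that in \<open>auto simp: keys_add_nat\<close>)
  then show ?thesis by (simp add: lookup_add sum.distrib)
qed

lemma mon_degree_zero [simp]: "mon_degree 0 = 0"
  by (simp add: mon_degree_def)

lemma mon_degree_single [simp]: "mon_degree (Poly_Mapping.single x n) = n"
  by (cases "n = 0") (simp_all add: mon_degree_def)

lemma poly_mapping_sum_single:
  "(\<Sum>m\<in>Poly_Mapping.keys p. Poly_Mapping.single m (Poly_Mapping.lookup p m)) = p"
  by (rule poly_mapping_eqI)
     (auto simp: lookup_sum lookup_single when_def in_keys_iff)

lemma keys_multE:
  assumes "m \<in> Poly_Mapping.keys (p * q)"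
  obtains m1 m2 where "m = m1 + m2" "m1 \<in> Poly_Mapping.keys p" "m2 \<in> Poly_Mapping.keys q"
  using keys_mult[of p q] assms by blast

text \<open>Multiplication by a monomial shifts exponents injectively, so no coefficients merge. In
  particular a variable is a nonzerodivisor over any coefficient ring.\<close>

lemma lookup_single_times:
  fixes p :: "('a, 'k::comm_ring_1) mpoly"
  shows "Poly_Mapping.lookup (Poly_Mapping.single s 1 * p) (s + m) = Poly_Mapping.lookup p m"
proof -
  have "Poly_Mapping.single s 1 * p =
      (\<Sum>k\<in>Poly_Mapping.keys p. Poly_Mapping.single (s + k) (Poly_Mapping.lookup p k))"
    by (subst poly_mapping_sum_single[of p, symmetric])
       (simp add: sum_distrib_left mult_single)
  then show ?thesis
    by (auto simp: lookup_sum lookup_single when_def in_keys_iff)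
qed

lemma mvar_times_eq_zero: "mvar v * p = 0 \<Longrightarrow> p = 0"
  by (rule poly_mapping_eqI) (metis lookup_single_times lookup_zero mvar_def)

text \<open>\<open>mapp\<close> acts only on the support, so the result is finitely supported for
  every \<open>Q\<close>. The two uses are homogeneous components and the terms divisible by one of
  a set of generators.\<close>

definition pfilter :: "('b \<Rightarrow> bool) \<Rightarrow> ('b \<Rightarrow>\<^sub>0 'c::zero) \<Rightarrow> 'b \<Rightarrow>\<^sub>0 'c" where
  "pfilter Q p = Poly_Mapping.mapp (\<lambda>m c. c when Q m) p"

lemma lookup_pfilter:
  "Poly_Mapping.lookup (pfilter Q p) m = (if Q m then Poly_Mapping.lookup p m else 0)"
  by (auto simp: pfilter_def lookup_mapp when_def in_keys_iff)

lemma keys_pfilter: "Poly_Mapping.keys (pfilter Q p) = {m \<in> Poly_Mapping.keys p. Q m}"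
  by (auto simp: in_keys_iff lookup_pfilter split: if_splits)

lemma pfilter_add: "pfilter Q (p + q) = pfilter Q p + pfilter Q q"
  for p q :: "'b \<Rightarrow>\<^sub>0 'c::monoid_add"
  by (rule poly_mapping_eqI) (simp add: lookup_pfilter lookup_add)

lemma pfilter_zero [simp]: "pfilter Q 0 = 0"
  by (rule poly_mapping_eqI) (simp add: lookup_pfilter)

lemma pfilter_sum: "pfilter Q (sum f A) = (\<Sum>x\<in>A. pfilter Q (f x))"
  for f :: "'d \<Rightarrow> 'b \<Rightarrow>\<^sub>0 'c::comm_monoid_add"
  by (induction A rule: infinite_finite_induct) (simp_all add: pfilter_add)

lemma pfilter_complement: "pfilter Q p + pfilter (\<lambda>m. \<not> Q m) p = p"
  for p :: "'b \<Rightarrow>\<^sub>0 'c::monoid_add"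
  by (rule poly_mapping_eqI) (simp add: lookup_pfilter lookup_add)

lemma pfilter_eq_self: "(\<And>m. m \<in> Poly_Mapping.keys p \<Longrightarrow> Q m) \<Longrightarrow> pfilter Q p = p"
  by (rule poly_mapping_eqI) (auto simp: lookup_pfilter in_keys_iff)

lemma pfilter_eq_zero: "(\<And>m. m \<in> Poly_Mapping.keys p \<Longrightarrow> \<not> Q m) \<Longrightarrow> pfilter Q p = 0"
  by (rule poly_mapping_eqI) (auto simp: lookup_pfilter in_keys_iff)

section \<open>Homogeneous components\<close>

definition hcomp :: "nat \<Rightarrow> ('a, 'k::comm_ring_1) mpoly \<Rightarrow> ('a, 'k) mpoly" where
  "hcomp j = pfilter (\<lambda>m. mon_degree m = j)"

lemma homogeneous_hcomp: "homogeneous j (hcomp j p)"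
  by (simp add: homogeneous_def hcomp_def keys_pfilter)

lemma hcomp_homogeneous: "homogeneous j p \<Longrightarrow> hcomp j p = p"
  by (simp add: homogeneous_def hcomp_def pfilter_eq_self)

lemma hcomp_zero [simp]: "hcomp j 0 = 0"
  by (simp add: hcomp_def)

text \<open>Split \<open>p\<close> into its component of degree \<open>j\<close> and the rest.
  Degrees add, so \<open>a\<close> times the rest has no term of degree
  \<open>e + j\<close>.\<close>

lemma hcomp_mult:
  assumes "homogeneous e a"
  shows "hcomp (e + j) (a * p) = a * hcomp j p"
proof -
  have 1: "hcomp (e + j) (a * hcomp j p) = a * hcomp j p"
    unfolding hcomp_def
    by (rule pfilter_eq_self)
       (use assms in \<open>auto simp: homogeneous_def keys_pfilter elim!: keys_multE\<close>)
  let ?r = "pfilter (\<lambda>m. mon_degree m \<noteq> j) p"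
  have 2: "hcomp (e + j) (a * ?r) = 0"
    unfolding hcomp_def
    by (rule pfilter_eq_zero)
       (use assms in \<open>auto simp: homogeneous_def keys_pfilter elim!: keys_multE\<close>)
  have "a * p = a * hcomp j p + a * ?r"
    unfolding hcomp_def distrib_left[symmetric] pfilter_complement ..
  then have "hcomp (e + j) (a * p) = hcomp (e + j) (a * hcomp j p) + hcomp (e + j) (a * ?r)"
    by (simp add: hcomp_def pfilter_add)
  with 1 2 show ?thesis by simp
qed

lemma homogeneous_zero [simp]: "homogeneous j 0"
  by (simp add: homogeneous_def)

lemma homogeneous_one [simp]: "homogeneous 0 1"
  by (simp add: homogeneous_def)

lemma homogeneous_mvar [simp]: "homogeneous 1 (mvar x)"
  by (simp add: homogeneous_def mvar_def)

lemma homogeneous_mult: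
  "homogeneous i p \<Longrightarrow> homogeneous j q \<Longrightarrow> homogeneous (i + j) (p * q)"
  by (auto simp: homogeneous_def elim!: keys_multE)

section \<open>The subring of polynomials in the variables from V\<close>

lemma polynomials_in_zero [simp]: "0 \<in> polynomials_in V"
  by (simp add: polynomials_in_def)

lemma polynomials_in_one [simp]: "1 \<in> polynomials_in V"
  by (simp add: polynomials_in_def)

lemma polynomials_in_mvar: "x \<in> V \<Longrightarrow> mvar x \<in> polynomials_in V"
  by (simp add: polynomials_in_def mvar_def)

lemma polynomials_in_add:
  "p \<in> polynomials_in V \<Longrightarrow> q \<in> polynomials_in V \<Longrightarrow> p + q \<in> polynomials_in V"
  using keys_add[of p q] unfolding polynomials_in_def by blast

lemma polynomials_in_uminus: "p \<in> polynomials_in V \<Longrightarrow> - p \<in> polynomials_in V"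
  by (simp add: polynomials_in_def in_keys_iff)

lemma polynomials_in_mult:
  "p \<in> polynomials_in V \<Longrightarrow> q \<in> polynomials_in V \<Longrightarrow> p * q \<in> polynomials_in V"
  unfolding polynomials_in_def by (auto 0 3 simp: keys_add_nat elim!: keys_multE)

lemma polynomials_in_hcomp: "p \<in> polynomials_in V \<Longrightarrow> hcomp j p \<in> polynomials_in V"
  by (auto simp: polynomials_in_def hcomp_def keys_pfilter)

lemma cring_polynomial_ring: "cring (polynomial_ring V :: ('a, 'k::comm_ring_1) mpoly ring)"
proof (rule cringI)
  show "abelian_group (polynomial_ring V :: ('a, 'k) mpoly ring)"
  proof (rule abelian_groupI)
    fix p :: "('a, 'k) mpoly"
    assume "p \<in> carrier (polynomial_ring V)"
    then show "\<exists>q\<in>carrier (polynomial_ring V). q \<oplus>\<^bsub>polynomial_ring V\<^esub> p = \<zero>\<^bsub>polynomial_ring V\<^esub>"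
      by (intro bexI[of _ "- p"]) (simp_all add: polynomial_ring_def polynomials_in_uminus)
  qed (auto simp: polynomial_ring_def polynomials_in_add add_ac)
  show "comm_monoid (polynomial_ring V :: ('a, 'k) mpoly ring)"
    by (rule comm_monoidI) (auto simp: polynomial_ring_def polynomials_in_mult mult_ac)
qed (simp add: polynomial_ring_def distrib_right)

section \<open>Monomial ideals\<close>

text \<open>The squarefree monomial ideal of \<open>D\<close>, encoded by supports: a monomial is
  divisible by the product over \<open>e\<close> exactly if its support contains \<open>e\<close>.
  Membership is thereby checked term by term, without generators.\<close>

definition mideal :: "'a set \<Rightarrow> 'a set set \<Rightarrow> ('a, 'k::comm_ring_1) mpoly set" where
  "mideal V D = {p \<in> polynomials_in V. \<forall>m\<in>Poly_Mapping.keys p. \<exists>e\<in>D. e \<subseteq> Poly_Mapping.keys m}"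

lemma mideal_zero [simp]: "0 \<in> mideal V D"
  by (simp add: mideal_def)

lemma mideal_add: "p \<in> mideal V D \<Longrightarrow> q \<in> mideal V D \<Longrightarrow> p + q \<in> mideal V D"
  using keys_add[of p q] polynomials_in_add[of p V q] unfolding mideal_def by blast

lemma mideal_uminus: "p \<in> mideal V D \<Longrightarrow> - p \<in> mideal V D"
  by (simp add: mideal_def polynomials_in_uminus in_keys_iff)

lemma mideal_mult:
  assumes "p \<in> polynomials_in V" "q \<in> mideal V D"
  shows "p * q \<in> mideal V D"
proof -
  have "\<exists>e\<in>D. e \<subseteq> Poly_Mapping.keys m" if "m \<in> Poly_Mapping.keys (p * q)" for m
  proof -
    obtain m1 m2 where "m = m1 + m2" "m2 \<in> Poly_Mapping.keys q"
      using \<open>m \<in> _\<close> by (rule keys_multE)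
    moreover from this obtain e where "e \<in> D" "e \<subseteq> Poly_Mapping.keys m2"
      using assms(2) unfolding mideal_def by blast
    ultimately show ?thesis by (auto simp: keys_add_nat)
  qed
  then show ?thesis using assms by (simp add: mideal_def polynomials_in_mult)
qed

lemma mideal_sum: "(\<And>x. x \<in> A \<Longrightarrow> f x \<in> mideal V D) \<Longrightarrow> sum f A \<in> mideal V D"
  by (induction A rule: infinite_finite_induct) (simp_all add: mideal_add)

lemma mideal_mono: "(\<And>e. e \<in> D \<Longrightarrow> \<exists>f\<in>E. f \<subseteq> e) \<Longrightarrow> mideal V D \<subseteq> mideal V E"
  unfolding mideal_def by (clarsimp, meson subset_trans)

lemma ideal_mideal:
  "ideal (mideal V D :: ('a, 'k::comm_ring_1) mpoly set) (polynomial_ring V)"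
proof -
  interpret cring "polynomial_ring V :: ('a, 'k) mpoly ring" by (rule cring_polynomial_ring)
  show ?thesis
  proof (rule idealI[OF ring_axioms])
    show "subgroup (mideal V D :: ('a, 'k) mpoly set) (add_monoid (polynomial_ring V))"
    proof (rule group.subgroupI[OF a_group])
      fix p :: "('a, 'k) mpoly"
      assume p: "p \<in> mideal V D"
      then have "p \<in> polynomials_in V" by (simp add: mideal_def)
      then have "inv\<^bsub>add_monoid (polynomial_ring V)\<^esub> p = - p"
        by (intro group.inv_equality[OF a_group])
           (simp_all add: polynomial_ring_def polynomials_in_uminus)
      with p show "inv\<^bsub>add_monoid (polynomial_ring V)\<^esub> p \<in> mideal V D"
        by (simp add: mideal_uminus)
    next
      show "mideal V D \<noteq> {}" using mideal_zero by blast
    qed (auto simp: polynomial_ring_def mideal_add, simp add: mideal_def)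
  next
    fix p q :: "('a, 'k) mpoly"
    assume "p \<in> mideal V D" "q \<in> carrier (polynomial_ring V)"
    then show "q \<otimes>\<^bsub>polynomial_ring V\<^esub> p \<in> mideal V D" "p \<otimes>\<^bsub>polynomial_ring V\<^esub> q \<in> mideal V D"
      by (simp_all add: polynomial_ring_def mideal_mult mult.commute[of p])
  qed
qed

section \<open>Squarefree monomials and the ideals they generate\<close>

definition set_monomial :: "'a set \<Rightarrow> 'a \<Rightarrow>\<^sub>0 nat" where
  "set_monomial e = (\<Sum>x\<in>e. Poly_Mapping.single x 1)"

lemma prod_mvar:
  "(\<Prod>x\<in>e. mvar x :: ('a, 'k::comm_ring_1) mpoly) = Poly_Mapping.single (set_monomial e) 1"
  unfolding set_monomial_def
  by (induction e rule: infinite_finite_induct) (simp_all add: mvar_def mult_single)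

lemma lookup_set_monomial:
  "finite e \<Longrightarrow> Poly_Mapping.lookup (set_monomial e) x = (if x \<in> e then 1 else 0)"
  by (simp add: set_monomial_def lookup_sum lookup_single when_def)

lemma keys_set_monomial: "finite e \<Longrightarrow> Poly_Mapping.keys (set_monomial e) = e"
  by (auto simp: in_keys_iff lookup_set_monomial split: if_splits)

lemma mon_degree_set_monomial: "finite e \<Longrightarrow> mon_degree (set_monomial e) = card e"
  by (simp add: mon_degree_def keys_set_monomial lookup_set_monomial)

lemma set_monomial_add_diff:
  assumes "finite e" "e \<subseteq> Poly_Mapping.keys m"
  shows "set_monomial e + (m - set_monomial e) = m"
  by (rule poly_mapping_eqI)
     (use assms in \<open>auto simp: lookup_add lookup_minus lookup_set_monomial in_keys_iff\<close>)

lemma keys_diff_subset: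
  "Poly_Mapping.keys (m - n) \<subseteq> Poly_Mapping.keys m" for m n :: "'a \<Rightarrow>\<^sub>0 nat"
  by (auto simp: in_keys_iff lookup_minus)

text \<open>A polynomial is the sum of its terms, and each term of a member of
  \<open>mideal V D\<close> is a multiple of a generator.\<close>

lemma circuit_ideal_eq_mideal:
  assumes D: "\<And>e. e \<in> D \<Longrightarrow> finite e \<and> e \<subseteq> V"
  shows "(circuit_ideal V D :: ('a, 'k::field) mpoly set) = mideal V D"
proof
  interpret cring "polynomial_ring V :: ('a, 'k) mpoly ring" by (rule cring_polynomial_ring)
  let ?G = "{\<Prod>x\<in>e. mvar x | e. e \<in> D} :: ('a, 'k) mpoly set"
  have G: "?G \<subseteq> mideal V D"
    using D by (force simp: prod_mvar mideal_def polynomials_in_def keys_set_monomial)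
  then show "circuit_ideal V D \<subseteq> (mideal V D :: ('a, 'k) mpoly set)"
    unfolding circuit_ideal_def by (rule genideal_minimal[OF ideal_mideal])
  have G': "?G \<subseteq> carrier (polynomial_ring V)"
    using G by (auto simp: mideal_def polynomial_ring_def)
  let ?I = "genideal (polynomial_ring V) ?G"
  interpret I: ideal ?I "polynomial_ring V :: ('a, 'k) mpoly ring"
    by (rule genideal_ideal[OF G'])
  have sum_in: "sum f A \<in> ?I" if "\<And>x. x \<in> A \<Longrightarrow> f x \<in> ?I"
    for f :: "('a \<Rightarrow>\<^sub>0 nat) \<Rightarrow> ('a, 'k) mpoly" and A
    using that
  proof (induction A rule: infinite_finite_induct)
    case (insert x A)
    then show ?case
      using I.a_closed[of "f x" "sum f A"] by (simp add: polynomial_ring_def)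
  qed (use I.zero_closed in \<open>simp_all add: polynomial_ring_def\<close>)
  show "(mideal V D :: ('a, 'k) mpoly set) \<subseteq> circuit_ideal V D"
  proof
    fix p :: "('a, 'k) mpoly"
    assume p: "p \<in> mideal V D"
    have "Poly_Mapping.single m (Poly_Mapping.lookup p m) \<in> ?I" if m: "m \<in> Poly_Mapping.keys p" for m
    proof -
      obtain e where e: "e \<in> D" "e \<subseteq> Poly_Mapping.keys m"
        using p m by (auto simp: mideal_def)
      \<comment> \<open>The cofactor of the generator for \<open>e\<close> in the term at
        \<open>m\<close>. Truncated subtraction of exponents is exact here because \<open>e\<close>
        lies in the support of \<open>m\<close>.\<close>
      let ?q = "Poly_Mapping.single (m - set_monomial e) (Poly_Mapping.lookup p m) :: ('a, 'k) mpoly"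
      have "Poly_Mapping.keys m \<subseteq> V"
        using p m by (auto simp: mideal_def polynomials_in_def)
      then have "?q \<in> carrier (polynomial_ring V)"
        using keys_diff_subset[of m "set_monomial e"]
        by (auto simp: polynomial_ring_def polynomials_in_def split: if_splits)
      moreover have "(\<Prod>x\<in>e. mvar x) \<in> ?I"
        using genideal_self[OF G'] e(1) by blast
      ultimately have "(\<Prod>x\<in>e. mvar x) * ?q \<in> ?I"
        using I.I_r_closed by (simp add: polynomial_ring_def)
      then show ?thesis
        using set_monomial_add_diff[of e m] D e by (simp add: prod_mvar mult_single)
    qed
    then have "(\<Sum>m\<in>Poly_Mapping.keys p. Poly_Mapping.single m (Poly_Mapping.lookup p m)) \<in> ?I"
      by (rule sum_in)
    then show "p \<in> circuit_ideal V D"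
      by (simp add: poly_mapping_sum_single circuit_ideal_def)
  qed
qed

lemma generated_in_degree_circuit_ideal:
  assumes "\<And>e. e \<in> D \<Longrightarrow> finite e \<and> e \<subseteq> V \<and> card e = d"
  shows "generated_in_degree V d (circuit_ideal V D :: ('a, 'k::field) mpoly set)"
  unfolding generated_in_degree_def circuit_ideal_def
  by (intro exI[of _ "{\<Prod>x\<in>e. mvar x | e. e \<in> D}"] conjI refl)
     (auto simp: prod_mvar polynomials_in_def homogeneous_def
        keys_set_monomial mon_degree_set_monomial dest!: assms)

text \<open>Lower the exponent of \<open>v\<close> by one in every term. The variable may vanish
  from the support, but the circuit \<open>e\<close> avoids \<open>v\<close> and therefore survives
  in it.\<close>

lemma mvar_dvd_mideal:
  fixes p :: "('a, 'k::comm_ring_1) mpoly"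
  assumes p: "p \<in> polynomials_in V"
    and m: "\<And>m. m \<in> Poly_Mapping.keys p \<Longrightarrow>
      v \<in> Poly_Mapping.keys m \<and> (\<exists>e\<in>D. v \<notin> e \<and> e \<subseteq> Poly_Mapping.keys m)"
  obtains q where "q \<in> mideal V D" "p = mvar v * q"
proof -
  let ?s = "Poly_Mapping.single v 1 :: 'a \<Rightarrow>\<^sub>0 nat"
  let ?q = "\<Sum>m\<in>Poly_Mapping.keys p. Poly_Mapping.single (m - ?s) (Poly_Mapping.lookup p m)"
  have s: "?s + (m - ?s) = m" if "m \<in> Poly_Mapping.keys p" for m
    using m[OF that] by (intro poly_mapping_eqI)
      (auto simp: lookup_add lookup_minus lookup_single when_def in_keys_iff)
  have "?q \<in> mideal V D"
  proof (rule mideal_sum)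
    fix m' assume m': "m' \<in> Poly_Mapping.keys p"
    then obtain e where e: "e \<in> D" "v \<notin> e" "e \<subseteq> Poly_Mapping.keys m'"
      using m by blast
    have "e \<subseteq> Poly_Mapping.keys (m' - ?s)"
      using e by (auto simp: in_keys_iff lookup_minus lookup_single when_def)
    then show "Poly_Mapping.single (m' - ?s) (Poly_Mapping.lookup p m') \<in> mideal V D"
      using e(1) m' p keys_diff_subset[of m' ?s] by (auto simp: mideal_def polynomials_in_def)
  qed
  moreover have "p = mvar v * ?q"
  proof -
    have "mvar v * ?q = (\<Sum>m\<in>Poly_Mapping.keys p. Poly_Mapping.single m (Poly_Mapping.lookup p m))"
      by (simp add: mvar_def sum_distrib_left mult_single s[unfolded One_nat_def])
    then show ?thesis by (simp add: poly_mapping_sum_single)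
  qed
  ultimately show ?thesis by (rule that)
qed

text \<open>Multiplication by \<open>mvar v\<close> adds only \<open>v\<close> to a support, and no
  generator contains \<open>v\<close>. This is the saturation condition needed for the ideal of the
  deletion.\<close>

lemma mvar_times_in_mideal:
  fixes f :: "('a, 'k::comm_ring_1) mpoly"
  assumes f: "f \<in> polynomials_in V" and xf: "mvar v * f \<in> mideal V D"
    and v: "\<And>e. e \<in> D \<Longrightarrow> v \<notin> e"
  shows "f \<in> mideal V D"
proof -
  have "\<exists>e\<in>D. e \<subseteq> Poly_Mapping.keys m" if "m \<in> Poly_Mapping.keys f" for m
  proof -
    have "Poly_Mapping.single v 1 + m \<in> Poly_Mapping.keys (mvar v * f)"
      using that by (simp only: in_keys_iff mvar_def lookup_single_times not_False_eq_True)
    then obtain e where e: "e \<in> D" "e \<subseteq> Poly_Mapping.keys (Poly_Mapping.single v 1 + m)"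
      using xf unfolding mideal_def by blast
    then have "e \<subseteq> Poly_Mapping.keys m"
      using v[OF e(1)] by (auto simp: keys_add_nat)
    with e(1) show ?thesis by blast
  qed
  with f show ?thesis by (simp add: mideal_def)
qed

text \<open>The sum x_v J + K is sorted by terms: a term that is divisible by no generator from
  \<open>D2\<close> must be divisible by x_v and a generator from \<open>D1\<close>.\<close>

lemma mideal_splitting:
  assumes "v \<in> V" "\<And>e. e \<in> D1 \<Longrightarrow> v \<notin> e"
  shows "(mideal V (insert v ` D1 \<union> D2) :: ('a, 'k::comm_ring_1) mpoly set) =
    {mvar v * j + k | j k. j \<in> mideal V D1 \<and> k \<in> mideal V D2}" (is "?I = ?S")
proof
  show "?I \<subseteq> ?S"
  proof
    fix p :: "('a, 'k) mpoly"
    assume p: "p \<in> ?I"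
    \<comment> \<open>Terms that qualify for both summands are assigned to the ideal of
      \<open>D2\<close>, so that everything left over is divisible by \<open>mvar v\<close>.\<close>
    define Q where "Q = (\<lambda>m :: 'a \<Rightarrow>\<^sub>0 nat. \<exists>e\<in>D2. e \<subseteq> Poly_Mapping.keys m)"
    have "pfilter Q p \<in> mideal V D2"
      using p by (auto simp: mideal_def polynomials_in_def keys_pfilter Q_def)
    moreover have "pfilter (\<lambda>m. \<not> Q m) p \<in> polynomials_in V"
      using p by (auto simp: mideal_def polynomials_in_def keys_pfilter)
    then obtain q where "q \<in> mideal V D1" "pfilter (\<lambda>m. \<not> Q m) p = mvar v * q"
    proof (rule mvar_dvd_mideal)
      fix m assume "m \<in> Poly_Mapping.keys (pfilter (\<lambda>m. \<not> Q m) p)"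
      then have m: "m \<in> Poly_Mapping.keys p" "\<not> Q m" by (auto simp: keys_pfilter)
      then obtain e where "e \<in> insert v ` D1" "e \<subseteq> Poly_Mapping.keys m"
        using p unfolding mideal_def Q_def by blast
      then show "v \<in> Poly_Mapping.keys m \<and> (\<exists>e\<in>D1. v \<notin> e \<and> e \<subseteq> Poly_Mapping.keys m)"
        using assms(2) by blast
    qed
    moreover from this have "p = mvar v * q + pfilter Q p"
      using pfilter_complement[of Q p] by (simp add: add.commute)
    ultimately show "p \<in> ?S" by blast
  qed
  show "?S \<subseteq> ?I"
  proof
    fix p :: "('a, 'k) mpoly"
    assume "p \<in> ?S"
    then obtain j k where jk: "j \<in> mideal V D1" "k \<in> mideal V D2" "p = mvar v * j + k"
      by blast
    have "\<exists>e\<in>insert v ` D1 \<union> D2. e \<subseteq> Poly_Mapping.keys m"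
      if m: "m \<in> Poly_Mapping.keys (mvar v * j)" for m
    proof -
      obtain m1 m' where m1: "m = m1 + m'" "m1 \<in> Poly_Mapping.keys (mvar v :: ('a, 'k) mpoly)"
          and m': "m' \<in> Poly_Mapping.keys j"
        using m by (rule keys_multE)
      then obtain e where "e \<in> D1" "e \<subseteq> Poly_Mapping.keys m'"
        using jk(1) unfolding mideal_def by blast
      moreover have "m1 = Poly_Mapping.single v 1"
        using m1(2) by (simp add: mvar_def)
      ultimately have "insert v e \<subseteq> Poly_Mapping.keys m" "insert v e \<in> insert v ` D1"
        by (auto simp: m1(1) keys_add_nat)
      then show ?thesis by blast
    qed
    then have "mvar v * j \<in> ?I"
      using jk(1) assms(1) by (simp add: mideal_def polynomials_in_mult polynomials_in_mvar)
    moreover have "k \<in> ?I"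
      using jk(2) mideal_mono[of D2 "insert v ` D1 \<union> D2" V] by blast
    ultimately show "p \<in> ?I" by (simp add: jk(3) mideal_add)
  qed
qed

section \<open>Graded submodules of free modules\<close>

lemma index_mult_mat_vec_sum:
  "A \<in> carrier_mat n p \<Longrightarrow> w \<in> carrier_vec p \<Longrightarrow> i < n \<Longrightarrow>
    (A *\<^sub>v w) $ i = (\<Sum>j<p. A $$ (i, j) * w $ j)"
  by (simp add: scalar_prod_def atLeast0LessThan)

lemma mult_mat_vec_smult:
  fixes A :: "'r::comm_ring_1 mat"
  assumes "A \<in> carrier_mat n p" "w \<in> carrier_vec p"
  shows "A *\<^sub>v (c \<cdot>\<^sub>v w) = c \<cdot>\<^sub>v (A *\<^sub>v w)"
  using assms by (intro eq_vecI) auto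

lemma smult_mat_mult_vec:
  fixes A :: "'r::comm_ring_1 mat"
  assumes "A \<in> carrier_mat n p" "w \<in> carrier_vec p"
  shows "(c \<cdot>\<^sub>m A) *\<^sub>v w = c \<cdot>\<^sub>v (A *\<^sub>v w)"
  using assms by (intro eq_vecI) auto

lemma uminus_vec_eq_smult: "- w = (- 1) \<cdot>\<^sub>v w" for w :: "'r::comm_ring_1 vec"
  by (intro eq_vecI) auto

lemma mult_mat_vec_uminus:
  fixes A :: "'r::comm_ring_1 mat"
  assumes "A \<in> carrier_mat n p" "w \<in> carrier_vec p"
  shows "A *\<^sub>v (- w) = - (A *\<^sub>v w)"
  unfolding uminus_vec_eq_smult by (rule mult_mat_vec_smult[OF assms])

lemma mult_mat_vec_zero: "A \<in> carrier_mat n p \<Longrightarrow> A *\<^sub>v 0\<^sub>v p = 0\<^sub>v n"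
  for A :: "'r::comm_ring_1 mat"
  by (intro eq_vecI) auto

lemma carrier_vec_appendE:
  assumes "u \<in> carrier_vec (n + m)"
  obtains v w where "u = v @\<^sub>v w" "v \<in> carrier_vec n" "w \<in> carrier_vec m"
  using assms vec_first_last_append vec_first_carrier vec_last_carrier by metis

section \<open>Closure properties and coordinates of free modules\<close>

lemma free_module_carrier: "w \<in> free_module V n \<Longrightarrow> w \<in> carrier_vec n"
  by (simp add: free_module_def)

lemma free_module_index: "w \<in> free_module V n \<Longrightarrow> i < n \<Longrightarrow> w $ i \<in> polynomials_in V"
  by (simp add: free_module_def)

lemma free_module_zero: "0\<^sub>v n \<in> free_module V n"
  by (simp add: free_module_def)

lemma free_module_0: "free_module V 0 = {0\<^sub>v 0}"
  by (auto simp: free_module_def)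

lemma free_module_add:
  "u \<in> free_module V n \<Longrightarrow> w \<in> free_module V n \<Longrightarrow> u + w \<in> free_module V n"
  by (auto simp: free_module_def polynomials_in_add)

lemma free_module_smult:
  "p \<in> polynomials_in V \<Longrightarrow> w \<in> free_module V n \<Longrightarrow> p \<cdot>\<^sub>v w \<in> free_module V n"
  by (auto simp: free_module_def polynomials_in_mult)

lemma free_module_uminus: "w \<in> free_module V n \<Longrightarrow> - w \<in> free_module V n"
  by (auto simp: free_module_def polynomials_in_uminus)

lemma free_module_append_iff:
  assumes "u \<in> carrier_vec n" "w \<in> carrier_vec m"
  shows "u @\<^sub>v w \<in> free_module V (n + m) \<longleftrightarrow> u \<in> free_module V n \<and> w \<in> free_module V m"
proof
  assume *: "u @\<^sub>v w \<in> free_module V (n + m)"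
  have "u $ i \<in> polynomials_in V" if "i < n" for i
    using free_module_index[OF *, of i] that assms by auto
  moreover have "w $ i \<in> polynomials_in V" if "i < m" for i
    using free_module_index[OF *, of "n + i"] that assms by auto
  ultimately show "u \<in> free_module V n \<and> w \<in> free_module V m"
    using assms by (auto simp: free_module_def)
next
  assume "u \<in> free_module V n \<and> w \<in> free_module V m"
  then show "u @\<^sub>v w \<in> free_module V (n + m)"
    using assms by (auto simp: free_module_def)
qed

lemma free_module_hcomp: "w \<in> free_module V n \<Longrightarrow> map_vec (hcomp j) w \<in> free_module V n"
  by (auto simp: free_module_def polynomials_in_hcomp)

text \<open>One degree for all entries suffices: in a linear resolution the basis elements of each
  free module share a single degree. Zero entries count as homogeneous of every degree.\<close>

definition homogeneous_mat ::
  "'a set \<Rightarrow> nat \<Rightarrow> nat \<Rightarrow> nat \<Rightarrow> ('a, 'k::comm_ring_1) mpoly mat \<Rightarrow> bool" where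
  "homogeneous_mat V e n p A \<longleftrightarrow> A \<in> carrier_mat n p \<and>
     (\<forall>i<n. \<forall>j<p. A $$ (i, j) \<in> polynomials_in V \<and> homogeneous e (A $$ (i, j)))"

definition syzygies :: "'a set \<Rightarrow> ('a, 'k::comm_ring_1) mpoly mat \<Rightarrow> ('a, 'k) mpoly vec set" where
  "syzygies V A = {w \<in> free_module V (dim_col A). A *\<^sub>v w = 0\<^sub>v (dim_row A)}"

lemma homogeneous_mat_carrier: "homogeneous_mat V e n p A \<Longrightarrow> A \<in> carrier_mat n p"
  by (simp add: homogeneous_mat_def)

lemma syzygies_alt:
  "A \<in> carrier_mat n p \<Longrightarrow> syzygies V A = {w \<in> free_module V p. A *\<^sub>v w = 0\<^sub>v n}"
  by (auto simp: syzygies_def)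

lemma hcomp_mult_mat_vec:
  assumes A: "homogeneous_mat V e n p A" and w: "w \<in> carrier_vec p"
  shows "map_vec (hcomp (e + j)) (A *\<^sub>v w) = A *\<^sub>v map_vec (hcomp j) w"
proof (rule eq_vecI)
  note A' = homogeneous_mat_carrier[OF A]
  show "dim_vec (map_vec (hcomp (e + j)) (A *\<^sub>v w)) = dim_vec (A *\<^sub>v map_vec (hcomp j) w)"
    by simp
  fix i assume "i < dim_vec (A *\<^sub>v map_vec (hcomp j) w)"
  then have i: "i < n" using A' by simp
  have "hcomp (e + j) (\<Sum>k<p. A $$ (i, k) * w $ k) = (\<Sum>k<p. A $$ (i, k) * hcomp j (w $ k))"
    unfolding hcomp_def pfilter_sum
    unfolding hcomp_def[symmetric]
    using A i by (intro sum.cong refl hcomp_mult) (auto simp: homogeneous_mat_def)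
  then show "map_vec (hcomp (e + j)) (A *\<^sub>v w) $ i = (A *\<^sub>v map_vec (hcomp j) w) $ i"
    using i A' w
    by (simp add: index_mult_mat_vec_sum[OF A'] del: index_mult_mat_vec)
qed

text \<open>All basis vectors are placed in the same degree, so homogeneous components are taken
  coordinatewise.\<close>

definition graded_submodule :: "'a set \<Rightarrow> nat \<Rightarrow> ('a, 'k::comm_ring_1) mpoly vec set \<Rightarrow> bool" where
  "graded_submodule V n U \<longleftrightarrow> U \<subseteq> free_module V n \<and> 0\<^sub>v n \<in> U \<and>
     (\<forall>u\<in>U. \<forall>w\<in>U. u + w \<in> U) \<and>
     (\<forall>p\<in>polynomials_in V. \<forall>u\<in>U. p \<cdot>\<^sub>v u \<in> U) \<and>
     (\<forall>j. \<forall>u\<in>U. map_vec (hcomp j) u \<in> U)"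

lemma graded_submodule_uminus:
  assumes "graded_submodule V n U" "u \<in> U"
  shows "- u \<in> U"
proof -
  have "- 1 \<in> polynomials_in V"
    by (rule polynomials_in_uminus) simp
  with assms show ?thesis
    unfolding graded_submodule_def uminus_vec_eq_smult by blast
qed

text \<open>Vectors of different dimensions share one type, without a common zero, so the linear
  combination is written coordinatewise.\<close>

lemma graded_submodule_combination:
  assumes U: "graded_submodule V n U"
    and b: "\<And>j. j < s \<Longrightarrow> b j \<in> U" and t: "t \<in> free_module V s"
  shows "vec n (\<lambda>i. \<Sum>j<s. b j $ i * t $ j) \<in> U"
proof -
  have "vec n (\<lambda>i. \<Sum>j<k. b j $ i * t $ j) \<in> U" if "k \<le> s" for k
    using that
  proof (induction k)
    case 0
    have "vec n (\<lambda>i. \<Sum>j<0. b j $ i * t $ j) = 0\<^sub>v n"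
      by (intro eq_vecI) auto
    then show ?case using U by (simp add: graded_submodule_def)
  next
    case (Suc k)
    have bk: "b k \<in> U" "b k \<in> carrier_vec n"
      using b[of k] Suc.prems U by (auto simp: graded_submodule_def free_module_def)
    have "vec n (\<lambda>i. \<Sum>j<Suc k. b j $ i * t $ j) = vec n (\<lambda>i. \<Sum>j<k. b j $ i * t $ j) + t $ k \<cdot>\<^sub>v b k"
      using bk by (intro eq_vecI) (auto simp: mult.commute)
    moreover have "t $ k \<cdot>\<^sub>v b k \<in> U"
      using U bk free_module_index[OF t, of k] Suc.prems by (auto simp: graded_submodule_def)
    ultimately show ?case
      using U Suc by (auto simp: graded_submodule_def)
  qed
  then show ?thesis by simp
qed

text \<open>The matrix raises all degrees by \<open>e\<close>, so it sends the component of degree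
  \<open>j\<close> of a syzygy to the component of degree \<open>e + j\<close> of zero.\<close>

lemma graded_submodule_syzygies:
  assumes A: "homogeneous_mat V e n p A"
  shows "graded_submodule V p (syzygies V A)"
proof -
  note A' = homogeneous_mat_carrier[OF A]
  have hcomp: "A *\<^sub>v map_vec (hcomp j) u = 0\<^sub>v n" if "u \<in> carrier_vec p" "A *\<^sub>v u = 0\<^sub>v n" for j u
  proof -
    have "map_vec (hcomp (e + j)) (0\<^sub>v n :: ('a, 'b) mpoly vec) = 0\<^sub>v n"
      by (intro eq_vecI) auto
    then show ?thesis
      using hcomp_mult_mat_vec[OF A that(1), of j] that(2) by simp
  qed
  have smult: "c \<cdot>\<^sub>v 0\<^sub>v n = (0\<^sub>v n :: ('a, 'b) mpoly vec)" for c
    by (intro eq_vecI) auto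
  show ?thesis
    unfolding graded_submodule_def syzygies_alt[OF A']
    using hcomp smult
    by (auto simp: free_module_zero free_module_add free_module_smult free_module_hcomp
        mult_mat_vec_zero[OF A'] mult_add_distrib_mat_vec[OF A'] mult_mat_vec_smult[OF A']
        free_module_carrier)
qed

section \<open>Submodules with linear resolutions\<close>

text \<open>A resolution is only asserted to exist step by step, so that membership of a module can be
  shown by coinduction, without constructing chain maps between resolutions.\<close>

coinductive linear_module ::
  "'a set \<Rightarrow> nat \<Rightarrow> nat \<Rightarrow> ('a, 'k::comm_ring_1) mpoly vec set \<Rightarrow> bool" for V where
  "homogeneous_mat V e n p A \<Longrightarrow> U = (\<lambda>w. A *\<^sub>v w) ` free_module V p \<Longrightarrow>
     linear_module V 1 p (syzygies V A) \<Longrightarrow> linear_module V e n U"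

text \<open>The zero module counts as linear in every degree \<open>e\<close>. This convention
  covers clutters without circuits, whose ideal is zero.\<close>

lemma linear_module_zero: "linear_module V e n {0\<^sub>v n :: ('a, 'k::comm_ring_1) mpoly vec}"
proof -
  \<comment> \<open>Rank and degree vary in the invariant: one step, through a matrix with no
    columns, leads to the zero module of rank 0 with degree 1.\<close>
  define Z where "Z = (\<lambda>(e::nat) n U. U = {0\<^sub>v n :: ('a, 'k) mpoly vec})"
  have "Z e n {0\<^sub>v n}" by (simp add: Z_def)
  then show ?thesis
  proof (coinduct rule: linear_module.coinduct)
    case (linear_module e n U)
    let ?A = "0\<^sub>m n 0 :: ('a, 'k) mpoly mat"
    have A: "?A *\<^sub>v 0\<^sub>v 0 = 0\<^sub>v n" by (intro eq_vecI) auto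
    then have "syzygies V ?A = {0\<^sub>v 0}"
      by (auto simp: syzygies_def free_module_0)
    with A show ?case
      using linear_module
      by (intro exI[of _ e] exI[of _ n] exI[of _ "0::nat"] exI[of _ ?A] exI[of _ U])
         (auto simp: Z_def homogeneous_mat_def free_module_0)
  qed
qed

text \<open>The identity matrix has entries of degree 0 and no syzygies. In rank 1 this handles the
  unit ideal, the base case of circuit size 0.\<close>

lemma linear_module_free: "linear_module V 0 n (free_module V n :: ('a, 'k::comm_ring_1) mpoly vec set)"
proof (rule linear_module.intros)
  show "homogeneous_mat V 0 n n (1\<^sub>m n :: ('a, 'k) mpoly mat)"
    by (simp add: homogeneous_mat_def one_mat_def)
  show "free_module V n = (\<lambda>w. (1\<^sub>m n :: ('a, 'k) mpoly mat) *\<^sub>v w) ` free_module V n"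
    by (force simp: free_module_carrier)
  have "syzygies V (1\<^sub>m n :: ('a, 'k) mpoly mat) = {0\<^sub>v n}"
    by (auto simp: syzygies_def free_module_carrier free_module_zero)
  then show "linear_module V 1 n (syzygies V (1\<^sub>m n :: ('a, 'k) mpoly mat))"
    by (simp add: linear_module_zero)
qed

lemma linear_moduleE [consumes 1]:
  assumes "linear_module V e n U"
  obtains p A where "homogeneous_mat V e n p A" "U = (\<lambda>w. A *\<^sub>v w) ` free_module V p"
    "linear_module V 1 p (syzygies V A)"
  using assms by (rule linear_module.cases) blast

text \<open>One step of the horseshoe lemma: \<open>U\<close> is an extension of its projection to the last \<open>n2\<close> coordinates
  by the kernel of that projection, and its syzygy module is again such an extension.\<close>

lemma horseshoe_step:
  fixes U :: "('a, 'k::comm_ring_1) mpoly vec set"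
  assumes U: "graded_submodule V (n1 + n2) U"
    and U1: "linear_module V e n1 {u \<in> carrier_vec n1. u @\<^sub>v 0\<^sub>v n2 \<in> U}"
    and U2: "linear_module V e n2 {w \<in> carrier_vec n2. \<exists>u \<in> carrier_vec n1. u @\<^sub>v w \<in> U}"
  obtains p q T where "homogeneous_mat V e (n1 + n2) (p + q) T"
    "U = (\<lambda>w. T *\<^sub>v w) ` free_module V (p + q)"
    "graded_submodule V (p + q) (syzygies V T)"
    "linear_module V 1 p {u \<in> carrier_vec p. u @\<^sub>v 0\<^sub>v q \<in> syzygies V T}"
    "linear_module V 1 q {w \<in> carrier_vec q. \<exists>u \<in> carrier_vec p. u @\<^sub>v w \<in> syzygies V T}"
proof -
  obtain p A where A: "homogeneous_mat V e n1 p A"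
      "{u \<in> carrier_vec n1. u @\<^sub>v 0\<^sub>v n2 \<in> U} = (\<lambda>w. A *\<^sub>v w) ` free_module V p"
      "linear_module V 1 p (syzygies V A)"
    using U1 by (rule linear_moduleE)
  obtain q C where C: "homogeneous_mat V e n2 q C"
      "{w \<in> carrier_vec n2. \<exists>u \<in> carrier_vec n1. u @\<^sub>v w \<in> U} = (\<lambda>w. C *\<^sub>v w) ` free_module V q"
      "linear_module V 1 q (syzygies V C)"
    using U2 by (rule linear_moduleE)
  note A' = homogeneous_mat_carrier[OF A(1)] and C' = homogeneous_mat_carrier[OF C(1)]
  have "\<exists>u. u \<in> carrier_vec n1 \<and> u @\<^sub>v col C j \<in> U \<and> (\<forall>i<n1. homogeneous e (u $ i))" if j: "j < q" for j
  proof -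
    have "C *\<^sub>v unit_vec q j = col C j"
      using C' j by (intro eq_vecI) auto
    moreover have "unit_vec q j \<in> free_module V q"
      by (simp add: free_module_def unit_vec_def)
    ultimately have "col C j \<in> {w \<in> carrier_vec n2. \<exists>u \<in> carrier_vec n1. u @\<^sub>v w \<in> U}"
      unfolding C(2) by (metis imageI)
    then obtain u where u: "u \<in> carrier_vec n1" "u @\<^sub>v col C j \<in> U" by blast
    \<comment> \<open>An arbitrary lift of the column need not be homogeneous. Its component of
      degree \<open>e\<close> still lies in \<open>U\<close> by gradedness and still lifts the
      column, which is itself homogeneous of degree \<open>e\<close>.\<close>
    have "map_vec (hcomp e) (u @\<^sub>v col C j) \<in> U"
      using U u(2) by (simp add: graded_submodule_def)
    moreover have "map_vec (hcomp e) (u @\<^sub>v col C j) = map_vec (hcomp e) u @\<^sub>v col C j"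
      using C C' u(1) j by (intro eq_vecI) (auto simp: homogeneous_mat_def hcomp_homogeneous)
    ultimately show ?thesis
      using u(1) by (intro exI[of _ "map_vec (hcomp e) u"]) (auto simp: homogeneous_hcomp)
  qed
  then obtain l where l: "\<And>j. j < q \<Longrightarrow> l j \<in> carrier_vec n1" "\<And>j. j < q \<Longrightarrow> l j @\<^sub>v col C j \<in> U"
      "\<And>j i. j < q \<Longrightarrow> i < n1 \<Longrightarrow> homogeneous e (l j $ i)"
    by metis
  define L where "L = mat n1 q (\<lambda>(i, j). l j $ i)"
  have L': "L \<in> carrier_mat n1 q" by (simp add: L_def)
  have "l j $ i \<in> polynomials_in V" if "j < q" "i < n1" for i j
  proof -
    have "l j @\<^sub>v col C j \<in> free_module V (n1 + n2)"
      using l(2)[OF that(1)] U by (auto simp: graded_submodule_def)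
    then have "l j \<in> free_module V n1"
      using free_module_append_iff[of "l j" n1 "col C j" n2] l(1)[OF that(1)] C' by auto
    then show ?thesis using that(2) by (rule free_module_index)
  qed
  then have L: "homogeneous_mat V e n1 q L"
    using l(3) by (simp add: homogeneous_mat_def L_def)
  have LC: "(L *\<^sub>v d) @\<^sub>v (C *\<^sub>v d) \<in> U" if d: "d \<in> free_module V q" for d
  proof -
    have "(L *\<^sub>v d) @\<^sub>v (C *\<^sub>v d) = vec (n1 + n2) (\<lambda>i. \<Sum>j<q. (l j @\<^sub>v col C j) $ i * d $ j)"
    proof (rule eq_vecI)
      fix i assume "i < dim_vec (vec (n1 + n2) (\<lambda>i. \<Sum>j<q. (l j @\<^sub>v col C j) $ i * d $ j))"
      then have i: "i < n1 + n2" by simp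
      have "(\<Sum>j<q. (l j @\<^sub>v col C j) $ i * d $ j) =
          (\<Sum>j<q. (if i < n1 then L $$ (i, j) else C $$ (i - n1, j)) * d $ j)"
        using i C' by (intro sum.cong refl) (auto simp: L_def carrier_vecD[OF l(1)])
      then show "((L *\<^sub>v d) @\<^sub>v (C *\<^sub>v d)) $ i =
          vec (n1 + n2) (\<lambda>i. \<Sum>j<q. (l j @\<^sub>v col C j) $ i * d $ j) $ i"
        using i L' C' free_module_carrier[OF d]
        by (simp add: index_mult_mat_vec_sum[OF L'] index_mult_mat_vec_sum[OF C'] del: index_mult_mat_vec)
    qed (use L' C' in simp)
    also have "\<dots> \<in> U"
      by (rule graded_submodule_combination[OF U l(2) d])
    finally show ?thesis .
  qed
  \<comment> \<open>The columns of \<open>A\<close> generate the kernel of the projection; those of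
    \<open>L\<close> over \<open>C\<close> lift the generators of its image.\<close>
  define T where "T = four_block_mat A L (0\<^sub>m n2 p) C"
  have T: "homogeneous_mat V e (n1 + n2) (p + q) T"
    using A(1) L C(1) A' L' C' by (auto simp: T_def homogeneous_mat_def)
  note T' = homogeneous_mat_carrier[OF T]
  have T_mult: "T *\<^sub>v (a @\<^sub>v d) = (A *\<^sub>v a + L *\<^sub>v d) @\<^sub>v (C *\<^sub>v d)"
    if "a \<in> carrier_vec p" "d \<in> carrier_vec q" for a d
  proof -
    have "0\<^sub>m n2 p *\<^sub>v a + C *\<^sub>v d = C *\<^sub>v d"
      using that C' by (intro eq_vecI) auto
    then show ?thesis
      unfolding T_def
      by (subst four_block_mat_mult_vec[OF A' L' zero_carrier_mat C' that]) simp
  qed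
  have A_iff: "u @\<^sub>v 0\<^sub>v n2 \<in> U \<longleftrightarrow> u \<in> (\<lambda>w. A *\<^sub>v w) ` free_module V p" if "u \<in> carrier_vec n1" for u
    using A(2) that by blast
  have "U = (\<lambda>w. T *\<^sub>v w) ` free_module V (p + q)"
  proof
    show "U \<subseteq> (\<lambda>w. T *\<^sub>v w) ` free_module V (p + q)"
    proof
      fix u assume u: "u \<in> U"
      then have "u \<in> carrier_vec (n1 + n2)"
        using U by (auto simp: graded_submodule_def free_module_def)
      then obtain v w where vw: "u = v @\<^sub>v w" "v \<in> carrier_vec n1" "w \<in> carrier_vec n2"
        by (rule carrier_vec_appendE)
      \<comment> \<open>Subtracting the lift that belongs to \<open>d\<close> cancels the last
        coordinates and leaves an element of the kernel, which \<open>A\<close> generates.\<close>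
      then obtain d where d: "d \<in> free_module V q" "w = C *\<^sub>v d"
        using C(2) u by blast
      have "u + - ((L *\<^sub>v d) @\<^sub>v (C *\<^sub>v d)) \<in> U"
        using U u LC[OF d(1)] graded_submodule_uminus[OF U] by (simp add: graded_submodule_def)
      moreover have "u + - ((L *\<^sub>v d) @\<^sub>v (C *\<^sub>v d)) = (v - L *\<^sub>v d) @\<^sub>v 0\<^sub>v n2"
        using vw d L' C' by (intro eq_vecI) auto
      moreover have "v - L *\<^sub>v d \<in> carrier_vec n1"
        using L' by (intro carrier_vecI) simp
      ultimately obtain a where a: "a \<in> free_module V p" "v - L *\<^sub>v d = A *\<^sub>v a"
        using A_iff[of "v - L *\<^sub>v d"] by auto
      have "A *\<^sub>v a + L *\<^sub>v d = v"
        unfolding a(2)[symmetric] using vw(2) L' by (intro eq_vecI) auto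
      then have "u = T *\<^sub>v (a @\<^sub>v d)"
        using T_mult[of a d] a d vw by (simp add: free_module_carrier)
      moreover have "a @\<^sub>v d \<in> free_module V (p + q)"
        using a d by (simp add: free_module_append_iff free_module_carrier)
      ultimately show "u \<in> (\<lambda>w. T *\<^sub>v w) ` free_module V (p + q)" by blast
    qed
    show "(\<lambda>w. T *\<^sub>v w) ` free_module V (p + q) \<subseteq> U"
    proof
      fix u assume "u \<in> (\<lambda>w. T *\<^sub>v w) ` free_module V (p + q)"
      then obtain b where b: "b \<in> free_module V (p + q)" "u = T *\<^sub>v b" by blast
      obtain a d where ad: "b = a @\<^sub>v d" "a \<in> carrier_vec p" "d \<in> carrier_vec q"
        using free_module_carrier[OF b(1)] by (rule carrier_vec_appendE)
      then have ad': "a \<in> free_module V p" "d \<in> free_module V q"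
        using b(1) free_module_append_iff by blast+
      have "A *\<^sub>v a @\<^sub>v 0\<^sub>v n2 \<in> U"
        using A_iff[of "A *\<^sub>v a"] A' ad' ad by auto
      then have "(A *\<^sub>v a @\<^sub>v 0\<^sub>v n2) + ((L *\<^sub>v d) @\<^sub>v (C *\<^sub>v d)) \<in> U"
        using U LC[OF ad'(2)] by (simp add: graded_submodule_def)
      moreover have "(A *\<^sub>v a @\<^sub>v 0\<^sub>v n2) + ((L *\<^sub>v d) @\<^sub>v (C *\<^sub>v d)) = u"
        unfolding b(2) ad(1) T_mult[OF ad(2,3)] using A' L' C' by (intro eq_vecI) auto
      ultimately show "u \<in> U" by simp
    qed
  qed
  moreover have "{u \<in> carrier_vec p. u @\<^sub>v 0\<^sub>v q \<in> syzygies V T} = syzygies V A"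
  proof -
    have "u @\<^sub>v 0\<^sub>v q \<in> syzygies V T \<longleftrightarrow> u \<in> syzygies V A" if "u \<in> carrier_vec p" for u
    proof -
      have "T *\<^sub>v (u @\<^sub>v 0\<^sub>v q) = (A *\<^sub>v u) @\<^sub>v 0\<^sub>v n2"
        unfolding T_mult[OF that zero_carrier_vec] mult_mat_vec_zero[OF L'] mult_mat_vec_zero[OF C']
        using A' that by simp
      moreover have "0\<^sub>v (n1 + n2) = 0\<^sub>v n1 @\<^sub>v (0\<^sub>v n2 :: ('a, 'k) mpoly vec)"
        by (intro eq_vecI) auto
      ultimately show ?thesis
        using that A'
        by (simp add: syzygies_alt[OF T'] syzygies_alt[OF A'] free_module_append_iff free_module_zero
            append_vec_eq[of _ n1])
    qed
    then show ?thesis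
      by (auto simp: syzygies_alt[OF A'] free_module_carrier)
  qed
  moreover have "{w \<in> carrier_vec q. \<exists>u \<in> carrier_vec p. u @\<^sub>v w \<in> syzygies V T} = syzygies V C"
  proof -
    have zero: "0\<^sub>v (n1 + n2) = 0\<^sub>v n1 @\<^sub>v (0\<^sub>v n2 :: ('a, 'k) mpoly vec)"
      by (intro eq_vecI) auto
    have iff: "u @\<^sub>v w \<in> syzygies V T \<longleftrightarrow>
        u \<in> free_module V p \<and> w \<in> syzygies V C \<and> A *\<^sub>v u + L *\<^sub>v w = 0\<^sub>v n1"
      if "u \<in> carrier_vec p" "w \<in> carrier_vec q" for u w
      using that A' L'
      by (auto simp: syzygies_alt[OF T'] syzygies_alt[OF C'] free_module_append_iff T_mult zero
          append_vec_eq[of _ n1])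
    have "\<exists>u \<in> carrier_vec p. u @\<^sub>v w \<in> syzygies V T" if w: "w \<in> syzygies V C" for w
    proof -
      have w': "w \<in> free_module V q" "C *\<^sub>v w = 0\<^sub>v n2"
        using w by (auto simp: syzygies_alt[OF C'])
      \<comment> \<open>A syzygy \<open>w\<close> of \<open>C\<close> has a lift with vanishing last
        coordinates, hence one in the image of \<open>A\<close>. Cancelling it by \<open>- a\<close>
        extends \<open>w\<close> to a syzygy of \<open>T\<close>, so the projection of syzygies is
        onto.\<close>
      have "L *\<^sub>v w @\<^sub>v 0\<^sub>v n2 \<in> U"
        using LC[OF w'(1)] w'(2) by simp
      then obtain a where a: "a \<in> free_module V p" "L *\<^sub>v w = A *\<^sub>v a"
        using A_iff[of "L *\<^sub>v w"] L' free_module_carrier[OF w'(1)] by auto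
      have "A *\<^sub>v (- a) + L *\<^sub>v w = 0\<^sub>v n1"
        using a A' mult_mat_vec_uminus[OF A'] by (simp add: free_module_carrier)
      then show ?thesis
        using a w w' by (intro bexI[of _ "- a"]) (simp_all add: iff free_module_carrier free_module_uminus)
    qed
    then show ?thesis
      using iff by (auto simp: syzygies_alt[OF C'] free_module_carrier)
  qed
  ultimately show ?thesis
    using that[OF T _ graded_submodule_syzygies[OF T]] A(3) C(3) by simp
qed

text \<open>Coinduction, with the horseshoe step preserving the invariant \<open>X\<close>. The
  decomposition of the rank is quantified inside \<open>X\<close> because it changes from
  \<open>n1 + n2\<close> to \<open>p + q\<close>.\<close>

lemma linear_module_extension:
  fixes U :: "('a, 'k::comm_ring_1) mpoly vec set"
  assumes "graded_submodule V (n1 + n2) U"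
    and "linear_module V e n1 {u \<in> carrier_vec n1. u @\<^sub>v 0\<^sub>v n2 \<in> U}"
    and "linear_module V e n2 {w \<in> carrier_vec n2. \<exists>u \<in> carrier_vec n1. u @\<^sub>v w \<in> U}"
  shows "linear_module V e (n1 + n2) U"
proof -
  define X where "X = (\<lambda>e n (U :: ('a, 'k) mpoly vec set). \<exists>n1 n2. n = n1 + n2 \<and>
    graded_submodule V n U \<and> linear_module V e n1 {u \<in> carrier_vec n1. u @\<^sub>v 0\<^sub>v n2 \<in> U} \<and>
    linear_module V e n2 {w \<in> carrier_vec n2. \<exists>u \<in> carrier_vec n1. u @\<^sub>v w \<in> U})"
  have "X e (n1 + n2) U"
    using assms unfolding X_def by blast
  then show ?thesis
  proof (coinduct rule: linear_module.coinduct)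
    case (linear_module e n U)
    then obtain n1 n2 where n: "n = n1 + n2" and U: "graded_submodule V (n1 + n2) U"
        "linear_module V e n1 {u \<in> carrier_vec n1. u @\<^sub>v 0\<^sub>v n2 \<in> U}"
        "linear_module V e n2 {w \<in> carrier_vec n2. \<exists>u \<in> carrier_vec n1. u @\<^sub>v w \<in> U}"
      unfolding X_def by blast
    obtain p q T where T: "homogeneous_mat V e (n1 + n2) (p + q) T"
        "U = (\<lambda>w. T *\<^sub>v w) ` free_module V (p + q)"
        "graded_submodule V (p + q) (syzygies V T)"
        "linear_module V 1 p {u \<in> carrier_vec p. u @\<^sub>v 0\<^sub>v q \<in> syzygies V T}"
        "linear_module V 1 q {w \<in> carrier_vec q. \<exists>u \<in> carrier_vec p. u @\<^sub>v w \<in> syzygies V T}"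
      using U by (rule horseshoe_step)
    have "X 1 (p + q) (syzygies V T)"
      unfolding X_def using T(3-5) by blast
    with T(1,2) n show ?case by blast
  qed
qed

section \<open>Sums of two images and their syzygies\<close>

definition hcat :: "'r mat \<Rightarrow> 'r mat \<Rightarrow> 'r mat" where
  "hcat A B = mat (dim_row A) (dim_col A + dim_col B)
     (\<lambda>(i, j). if j < dim_col A then A $$ (i, j) else B $$ (i, j - dim_col A))"

lemma hcat_mult_vec:
  fixes A B :: "'r::comm_ring_1 mat"
  assumes "A \<in> carrier_mat n p" "B \<in> carrier_mat n q" "u \<in> carrier_vec p" "w \<in> carrier_vec q"
  shows "hcat A B *\<^sub>v (u @\<^sub>v w) = A *\<^sub>v u + B *\<^sub>v w"
proof (rule eq_vecI)
  fix i assume "i < dim_vec (A *\<^sub>v u + B *\<^sub>v w)"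
  then have i: "i < n" using assms by simp
  have "row (hcat A B) i = row A i @\<^sub>v row B i"
    using assms i by (intro eq_vecI) (auto simp: hcat_def)
  moreover have "(row A i @\<^sub>v row B i) \<bullet> (u @\<^sub>v w) = row A i \<bullet> u + row B i \<bullet> w"
    by (rule scalar_prod_append) (use assms in auto)
  ultimately show "(hcat A B *\<^sub>v (u @\<^sub>v w)) $ i = (A *\<^sub>v u + B *\<^sub>v w) $ i"
    using assms i by (simp add: hcat_def)
qed (use assms in \<open>simp add: hcat_def\<close>)

lemma homogeneous_mat_hcat:
  "homogeneous_mat V e n p A \<Longrightarrow> homogeneous_mat V e n q B \<Longrightarrow> homogeneous_mat V e n (p + q) (hcat A B)"
  by (auto simp: homogeneous_mat_def hcat_def)

lemma homogeneous_mat_smult: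
  "x \<in> polynomials_in V \<Longrightarrow> homogeneous 1 x \<Longrightarrow> homogeneous_mat V e n p A \<Longrightarrow>
    homogeneous_mat V (Suc e) n p (x \<cdot>\<^sub>m A)"
  using homogeneous_mult[of 1 x e] by (auto simp: homogeneous_mat_def polynomials_in_mult)

lemma hcat_image:
  fixes A B :: "('a, 'k::comm_ring_1) mpoly mat"
  assumes "A \<in> carrier_mat n p" "B \<in> carrier_mat n q"
  shows "(\<lambda>w. hcat A B *\<^sub>v w) ` free_module V (p + q) =
    {A *\<^sub>v u + B *\<^sub>v w | u w. u \<in> free_module V p \<and> w \<in> free_module V q}" (is "?L = ?R")
proof
  show "?L \<subseteq> ?R"
  proof
    fix y assume "y \<in> ?L"
    then obtain b where b: "b \<in> free_module V (p + q)" "y = hcat A B *\<^sub>v b" by blast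
    obtain u w where uw: "b = u @\<^sub>v w" "u \<in> carrier_vec p" "w \<in> carrier_vec q"
      using free_module_carrier[OF b(1)] by (rule carrier_vec_appendE)
    then show "y \<in> ?R"
      using b hcat_mult_vec[OF assms uw(2,3)] free_module_append_iff[OF uw(2,3)] by blast
  qed
  show "?R \<subseteq> ?L"
  proof
    fix y assume "y \<in> ?R"
    then obtain u w where uw: "u \<in> free_module V p" "w \<in> free_module V q" "y = A *\<^sub>v u + B *\<^sub>v w"
      by blast
    then have "y = hcat A B *\<^sub>v (u @\<^sub>v w)" "u @\<^sub>v w \<in> free_module V (p + q)"
      using hcat_mult_vec[OF assms] by (simp_all add: free_module_append_iff free_module_carrier)
    then show "y \<in> ?L" by blast
  qed
qed

lemma append_in_syzygies_hcat_iff: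
  fixes A B :: "('a, 'k::comm_ring_1) mpoly mat"
  assumes "A \<in> carrier_mat n p" "B \<in> carrier_mat n q" "u \<in> carrier_vec p" "w \<in> carrier_vec q"
  shows "u @\<^sub>v w \<in> syzygies V (hcat A B) \<longleftrightarrow>
    u \<in> free_module V p \<and> w \<in> free_module V q \<and> A *\<^sub>v u + B *\<^sub>v w = 0\<^sub>v n"
proof -
  have "hcat A B \<in> carrier_mat n (p + q)"
    using assms by (auto simp: hcat_def)
  then show ?thesis
    using assms by (simp add: syzygies_alt free_module_append_iff hcat_mult_vec)
qed

text \<open>The syzygies of \<open>hcat A B\<close> project to the last \<open>q\<close> coordinates
  with kernel the syzygies of \<open>A\<close> and image the \<open>w\<close> that \<open>B\<close>
  sends into the image of \<open>A\<close>. Assumptions \<open>syz\<close> and \<open>proj\<close>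
  say that both ends of this extension are linear.\<close>

lemma linear_module_hcat:
  fixes A B :: "('a, 'k::comm_ring_1) mpoly mat"
  assumes A: "homogeneous_mat V e n p A" and B: "homogeneous_mat V e n q B"
    and syz: "linear_module V 1 p (syzygies V A)"
    and proj: "linear_module V 1 q {w \<in> free_module V q. \<exists>u \<in> free_module V p. B *\<^sub>v w = A *\<^sub>v u}"
  shows "linear_module V e n {A *\<^sub>v u + B *\<^sub>v w | u w. u \<in> free_module V p \<and> w \<in> free_module V q}"
proof (rule linear_module.intros)
  note A' = homogeneous_mat_carrier[OF A] and B' = homogeneous_mat_carrier[OF B]
  show H: "homogeneous_mat V e n (p + q) (hcat A B)"
    by (rule homogeneous_mat_hcat[OF A B])
  show "{A *\<^sub>v u + B *\<^sub>v w | u w. u \<in> free_module V p \<and> w \<in> free_module V q} =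
      (\<lambda>w. hcat A B *\<^sub>v w) ` free_module V (p + q)"
    by (rule hcat_image[OF A' B', symmetric])
  have 1: "{u \<in> carrier_vec p. u @\<^sub>v 0\<^sub>v q \<in> syzygies V (hcat A B)} = syzygies V A"
    using A' B'
    by (auto simp: append_in_syzygies_hcat_iff[OF A' B'] syzygies_alt[OF A'] free_module_zero
        free_module_carrier mult_mat_vec_zero[OF B'])
  have 2: "{w \<in> carrier_vec q. \<exists>u \<in> carrier_vec p. u @\<^sub>v w \<in> syzygies V (hcat A B)} =
      {w \<in> free_module V q. \<exists>u \<in> free_module V p. B *\<^sub>v w = A *\<^sub>v u}" (is "?L = ?R")
  proof
    show "?L \<subseteq> ?R"
    proof
      fix w assume "w \<in> ?L"
      then obtain u where u: "u \<in> free_module V p" "w \<in> free_module V q" "A *\<^sub>v u + B *\<^sub>v w = 0\<^sub>v n"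
        using append_in_syzygies_hcat_iff[OF A' B'] by blast
      have "B *\<^sub>v w = A *\<^sub>v (- u)"
      proof (rule eq_vecI)
        fix i assume "i < dim_vec (A *\<^sub>v (- u))"
        then have i: "i < n" using A' by simp
        have "(A *\<^sub>v u) $ i + (B *\<^sub>v w) $ i = 0"
          using arg_cong[OF u(3), of "\<lambda>v. v $ i"] i A' B' by simp
        then show "(B *\<^sub>v w) $ i = (A *\<^sub>v (- u)) $ i"
          unfolding mult_mat_vec_uminus[OF A' free_module_carrier[OF u(1)]]
          using i A' by (simp add: eq_neg_iff_add_eq_0 add.commute)
      qed (use A' B' in simp)
      then show "w \<in> ?R" using u free_module_uminus by blast
    qed
    show "?R \<subseteq> ?L"
    proof
      fix w assume "w \<in> ?R"
      then obtain u where u: "u \<in> free_module V p" "w \<in> free_module V q" "B *\<^sub>v w = A *\<^sub>v u"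
        by blast
      have "A *\<^sub>v (- u) + B *\<^sub>v w = 0\<^sub>v n"
        unfolding u(3) mult_mat_vec_uminus[OF A' free_module_carrier[OF u(1)]]
        using A' u(1) by (simp add: free_module_carrier)
      then have "- u @\<^sub>v w \<in> syzygies V (hcat A B)"
        using u by (simp add: append_in_syzygies_hcat_iff[OF A' B'] free_module_carrier free_module_uminus)
      then show "w \<in> ?L"
        using u(1,2) free_module_carrier uminus_carrier_vec by blast
    qed
  qed
  show "linear_module V 1 (p + q) (syzygies V (hcat A B))"
    by (rule linear_module_extension[OF graded_submodule_syzygies[OF H]])
       (simp_all only: 1 2 syz proj)
qed

text \<open>The syzygies of \<open>x J + K\<close> are an extension of \<open>x F + Syz K\<close> by \<open>Syz J\<close>, where \<open>F\<close> is the
  free module of generators of \<open>K\<close>, and the syzygies of \<open>x F + Syz K\<close> are an extension of \<open>Syz K\<close>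
  by the first syzygies of \<open>Syz K\<close>.\<close>

lemma linear_module_splitting:
  fixes J K :: "('a, 'k::comm_ring_1) mpoly vec set"
  assumes x: "x \<in> polynomials_in V" "homogeneous 1 x" and reg: "\<And>p. x * p = 0 \<Longrightarrow> p = 0"
    and J: "linear_module V d n J" and K: "linear_module V (Suc d) n K"
    and "K \<subseteq> J" and saturated: "\<And>j. j \<in> J \<Longrightarrow> x \<cdot>\<^sub>v j \<in> K \<Longrightarrow> j \<in> K"
  shows "linear_module V (Suc d) n {x \<cdot>\<^sub>v j + k | j k. j \<in> J \<and> k \<in> K}"
proof -
  obtain p M where M: "homogeneous_mat V d n p M" "J = (\<lambda>w. M *\<^sub>v w) ` free_module V p"
      "linear_module V 1 p (syzygies V M)"
    using J by (rule linear_moduleE)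
  obtain q N where N: "homogeneous_mat V (Suc d) n q N" "K = (\<lambda>w. N *\<^sub>v w) ` free_module V q"
      "linear_module V 1 q (syzygies V N)"
    using K by (rule linear_moduleE)
  obtain r N1 where N1: "homogeneous_mat V 1 q r N1" "syzygies V N = (\<lambda>w. N1 *\<^sub>v w) ` free_module V r"
      "linear_module V 1 r (syzygies V N1)"
    using N(3) by (rule linear_moduleE)
  note M' = homogeneous_mat_carrier[OF M(1)] and N' = homogeneous_mat_carrier[OF N(1)]
    and N1' = homogeneous_mat_carrier[OF N1(1)]
  have reg_vec: "w = 0\<^sub>v m" if "x \<cdot>\<^sub>v w = 0\<^sub>v m" "w \<in> carrier_vec m" for w m
  proof (rule eq_vecI)
    fix i assume "i < dim_vec (0\<^sub>v m :: ('a, 'k) mpoly vec)"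
    then show "w $ i = 0\<^sub>v m $ i"
      using arg_cong[OF that(1), of "\<lambda>v. v $ i"] that(2) reg by simp
  qed (use that in simp)
  \<comment> \<open>The submodule x F is the image of x times the identity, so x F + Syz K is again
    a sum of two images.\<close>
  let ?I = "x \<cdot>\<^sub>m 1\<^sub>m q :: ('a, 'k) mpoly mat"
  have I: "homogeneous_mat V 1 q q ?I"
    using homogeneous_mat_smult[OF x, of 0 q q "1\<^sub>m q"] by (simp add: homogeneous_mat_def one_mat_def)
  have I_mult: "?I *\<^sub>v t = x \<cdot>\<^sub>v t" if "t \<in> free_module V q" for t
    using smult_mat_mult_vec[OF one_carrier_mat free_module_carrier[OF that]] that
    by (simp add: free_module_carrier)
  have zero: "x \<cdot>\<^sub>v 0\<^sub>v m = (0\<^sub>v m :: ('a, 'k) mpoly vec)" for m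
    by (intro eq_vecI) auto
  let ?P = "{N1 *\<^sub>v s + ?I *\<^sub>v t | s t. s \<in> free_module V r \<and> t \<in> free_module V q}"
  \<comment> \<open>Since x is a nonzerodivisor, x t is a syzygy of \<open>N\<close> exactly if t
    is. Hence the linearity of Syz K serves as the projection hypothesis for
    \<open>?P\<close>.\<close>
  have "{t \<in> free_module V q. \<exists>s\<in>free_module V r. ?I *\<^sub>v t = N1 *\<^sub>v s} = syzygies V N"
  proof -
    have "(\<exists>s\<in>free_module V r. ?I *\<^sub>v t = N1 *\<^sub>v s) \<longleftrightarrow> N *\<^sub>v t = 0\<^sub>v n" if t: "t \<in> free_module V q" for t
    proof -
      have "(\<exists>s\<in>free_module V r. ?I *\<^sub>v t = N1 *\<^sub>v s) \<longleftrightarrow> x \<cdot>\<^sub>v t \<in> syzygies V N"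
        unfolding N1(2) using I_mult[OF t] by auto
      also have "\<dots> \<longleftrightarrow> x \<cdot>\<^sub>v (N *\<^sub>v t) = 0\<^sub>v n"
        using t x by (simp add: syzygies_alt[OF N'] free_module_smult mult_mat_vec_smult[OF N'] free_module_carrier)
      also have "\<dots> \<longleftrightarrow> N *\<^sub>v t = 0\<^sub>v n"
        using reg_vec[of "N *\<^sub>v t" n] N' t zero by (auto simp: free_module_carrier)
      finally show ?thesis .
    qed
    then show ?thesis by (auto simp: syzygies_alt[OF N'])
  qed
  then have P: "linear_module V 1 q ?P"
    using linear_module_hcat[OF N1(1) I N1(3)] N(3) by simp
  have "{w \<in> free_module V q. \<exists>u\<in>free_module V p. N *\<^sub>v w = (x \<cdot>\<^sub>m M) *\<^sub>v u} = ?P" (is "?L = _")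
  proof
    show "?L \<subseteq> ?P"
    proof
      fix w assume "w \<in> ?L"
      then obtain u where u: "w \<in> free_module V q" "u \<in> free_module V p" "N *\<^sub>v w = (x \<cdot>\<^sub>m M) *\<^sub>v u"
        by blast
      have Nw: "N *\<^sub>v w = x \<cdot>\<^sub>v (M *\<^sub>v u)"
        using u smult_mat_mult_vec[OF M'] by (simp add: free_module_carrier)
      \<comment> \<open>Cancelling x modulo K turns N w = x M u into M u = N t for some t; then w -
        x t is a syzygy of \<open>N\<close>.\<close>
      have "M *\<^sub>v u \<in> K"
      proof (rule saturated)
        show "M *\<^sub>v u \<in> J" using M(2) u(2) by blast
        show "x \<cdot>\<^sub>v (M *\<^sub>v u) \<in> K" unfolding Nw[symmetric] N(2) using u(1) by blast
      qed
      then obtain t where t: "t \<in> free_module V q" "M *\<^sub>v u = N *\<^sub>v t"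
        using N(2) by blast
      have xt: "x \<cdot>\<^sub>v t \<in> free_module V q" using t(1) x(1) by (rule free_module_smult[rotated])
      have "N *\<^sub>v (w + - (x \<cdot>\<^sub>v t)) = N *\<^sub>v w + - (x \<cdot>\<^sub>v (N *\<^sub>v t))"
        using u(1) t(1) xt
        by (simp add: mult_add_distrib_mat_vec[OF N'] mult_mat_vec_uminus[OF N'] mult_mat_vec_smult[OF N']
            free_module_carrier)
      also have "\<dots> = 0\<^sub>v n"
        unfolding Nw t(2) using N' t(1) by (simp add: free_module_carrier)
      finally have "w + - (x \<cdot>\<^sub>v t) \<in> syzygies V N"
        using u(1) xt by (simp add: syzygies_alt[OF N'] free_module_add free_module_uminus)
      then obtain s where s: "s \<in> free_module V r" "w + - (x \<cdot>\<^sub>v t) = N1 *\<^sub>v s"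
        using N1(2) by blast
      have "w = N1 *\<^sub>v s + ?I *\<^sub>v t"
        unfolding s(2)[symmetric] I_mult[OF t(1)]
        using free_module_carrier[OF u(1)] free_module_carrier[OF t(1)] by (intro eq_vecI) auto
      then show "w \<in> ?P" using s(1) t(1) by blast
    qed
    show "?P \<subseteq> ?L"
    proof
      fix w assume "w \<in> ?P"
      then obtain s t where st: "s \<in> free_module V r" "t \<in> free_module V q" "w = N1 *\<^sub>v s + ?I *\<^sub>v t"
        by blast
      have "N1 *\<^sub>v s \<in> syzygies V N" using N1(2) st(1) by blast
      then have s: "N1 *\<^sub>v s \<in> free_module V q" "N *\<^sub>v (N1 *\<^sub>v s) = 0\<^sub>v n"
        by (auto simp: syzygies_alt[OF N'])
      have xt: "x \<cdot>\<^sub>v t \<in> free_module V q" using st(2) x(1) by (rule free_module_smult[rotated])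
      have w: "w \<in> free_module V q"
        unfolding st(3) I_mult[OF st(2)] using s(1) xt by (rule free_module_add)
      have "N *\<^sub>v t \<in> J" using \<open>K \<subseteq> J\<close> N(2) st(2) by blast
      then obtain u where u: "u \<in> free_module V p" "N *\<^sub>v t = M *\<^sub>v u"
        using M(2) by blast
      have "N *\<^sub>v w = 0\<^sub>v n + x \<cdot>\<^sub>v (N *\<^sub>v t)"
        unfolding st(3) I_mult[OF st(2)]
        using s xt st(2)
        by (simp add: mult_add_distrib_mat_vec[OF N'] mult_mat_vec_smult[OF N'] free_module_carrier)
      also have "\<dots> = (x \<cdot>\<^sub>m M) *\<^sub>v u"
        unfolding u(2) using smult_mat_mult_vec[OF M'] u(1) M' by (simp add: free_module_carrier)
      finally show "w \<in> ?L" using w u(1) by blast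
    qed
  qed
  with P have proj: "linear_module V 1 q
      {w \<in> free_module V q. \<exists>u\<in>free_module V p. N *\<^sub>v w = (x \<cdot>\<^sub>m M) *\<^sub>v u}"
    by simp
  \<comment> \<open>Again x can be cancelled, so scaling the generators of J by x leaves their
    syzygies unchanged.\<close>
  have "(x \<cdot>\<^sub>m M) *\<^sub>v w = 0\<^sub>v n \<longleftrightarrow> M *\<^sub>v w = 0\<^sub>v n" if "w \<in> free_module V p" for w
    using reg_vec[of "M *\<^sub>v w" n] smult_mat_mult_vec[OF M'] M' that zero by (auto simp: free_module_carrier)
  then have "syzygies V (x \<cdot>\<^sub>m M) = syzygies V M"
    using M' by (auto simp: syzygies_alt[OF M'] syzygies_alt[OF smult_carrier_mat[OF M']])
  then have "linear_module V (Suc d) n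
      {(x \<cdot>\<^sub>m M) *\<^sub>v u + N *\<^sub>v w | u w. u \<in> free_module V p \<and> w \<in> free_module V q}"
    using linear_module_hcat[OF homogeneous_mat_smult[OF x M(1)] N(1)] M(3) proj by simp
  moreover have "{(x \<cdot>\<^sub>m M) *\<^sub>v u + N *\<^sub>v w | u w. u \<in> free_module V p \<and> w \<in> free_module V q} =
      {x \<cdot>\<^sub>v j + k | j k. j \<in> J \<and> k \<in> K}"
    (is "?L = ?R")
  proof
    have eq: "(x \<cdot>\<^sub>m M) *\<^sub>v u = x \<cdot>\<^sub>v (M *\<^sub>v u)" if "u \<in> free_module V p" for u
      using smult_mat_mult_vec[OF M' free_module_carrier[OF that]] .
    show "?L \<subseteq> ?R"
    proof
      fix y assume "y \<in> ?L"
      then obtain u w where uw: "u \<in> free_module V p" "w \<in> free_module V q"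
          "y = (x \<cdot>\<^sub>m M) *\<^sub>v u + N *\<^sub>v w"
        by blast
      have "M *\<^sub>v u \<in> J" "N *\<^sub>v w \<in> K"
        unfolding M(2) N(2) using uw by blast+
      moreover have "y = x \<cdot>\<^sub>v (M *\<^sub>v u) + N *\<^sub>v w"
        unfolding uw(3) eq[OF uw(1)] ..
      ultimately show "y \<in> ?R" by blast
    qed
    show "?R \<subseteq> ?L"
    proof
      fix y assume "y \<in> ?R"
      then obtain j k where jk: "j \<in> J" "k \<in> K" "y = x \<cdot>\<^sub>v j + k" by blast
      obtain u where u: "u \<in> free_module V p" "j = M *\<^sub>v u"
        using M(2) jk(1) by blast
      obtain w where w: "w \<in> free_module V q" "k = N *\<^sub>v w"
        using N(2) jk(2) by blast
      have "y = (x \<cdot>\<^sub>m M) *\<^sub>v u + N *\<^sub>v w"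
        unfolding jk(3) u(2) w(2) eq[OF u(1)] ..
      with u(1) w(1) show "y \<in> ?L" by blast
    qed
  qed
  ultimately show ?thesis by simp
qed

section \<open>Resolutions of ideals\<close>

text \<open>Identifies the ring with its free module of rank 1, so that ideals become submodules to
  which \<open>linear_module\<close> applies.\<close>

definition vec1 :: "'r \<Rightarrow> 'r vec" where
  "vec1 p = vec 1 (\<lambda>_. p)"

lemma vec1_index [simp]: "vec1 p $ 0 = p"
  by (simp add: vec1_def)

lemma vec1_combination: "x \<cdot>\<^sub>v vec1 p + vec1 q = vec1 (x * p + q)"
  by (intro eq_vecI) (auto simp: vec1_def)

lemma vec1_smult: "x \<cdot>\<^sub>v vec1 p = vec1 (x * p)"
  by (intro eq_vecI) (auto simp: vec1_def)

lemma vec1_inject [simp]: "vec1 p = vec1 q \<longleftrightarrow> p = q"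
  by (metis vec1_index)

lemma vec1_image_polynomials_in: "vec1 ` polynomials_in V = free_module V 1"
proof
  show "free_module V 1 \<subseteq> vec1 ` polynomials_in V"
  proof
    fix w assume w: "w \<in> free_module V 1"
    then have "w = vec1 (w $ 0)"
      by (intro eq_vecI) (auto simp: free_module_def vec1_def)
    with w show "w \<in> vec1 ` polynomials_in V"
      using free_module_index[OF w, of 0] by auto
  qed
qed (auto simp: free_module_def vec1_def)

text \<open>Assumption \<open>sub\<close> yields K <= J, while \<open>D2\<close> avoiding
  \<open>v\<close> yields saturation.\<close>

lemma linear_module_mideal_splitting:
  assumes "v \<in> V" and D1: "\<And>e. e \<in> D1 \<Longrightarrow> v \<notin> e" and D2: "\<And>e. e \<in> D2 \<Longrightarrow> v \<notin> e"
    and sub: "\<And>e. e \<in> D2 \<Longrightarrow> \<exists>f\<in>D1. f \<subseteq> e"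
    and J: "linear_module V d 1 (vec1 ` mideal V D1 :: ('a, 'k::comm_ring_1) mpoly vec set)"
    and K: "linear_module V (Suc d) 1 (vec1 ` mideal V D2 :: ('a, 'k) mpoly vec set)"
  shows "linear_module V (Suc d) 1
    (vec1 ` mideal V (insert v ` D1 \<union> D2) :: ('a, 'k) mpoly vec set)"
proof -
  have "linear_module V (Suc d) 1 {mvar v \<cdot>\<^sub>v j + k | j k :: ('a, 'k) mpoly vec.
      j \<in> vec1 ` mideal V D1 \<and> k \<in> vec1 ` mideal V D2}"
  proof (rule linear_module_splitting[OF polynomials_in_mvar[OF \<open>v \<in> V\<close>] homogeneous_mvar _ J K])
    show "vec1 ` mideal V D2 \<subseteq> (vec1 ` mideal V D1 :: ('a, 'k) mpoly vec set)"
      using mideal_mono[OF sub] by (rule image_mono)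
    fix j :: "('a, 'k) mpoly vec"
    assume "j \<in> vec1 ` mideal V D1" "mvar v \<cdot>\<^sub>v j \<in> vec1 ` mideal V D2"
    then obtain f where f: "j = vec1 f" "f \<in> polynomials_in V" "mvar v * f \<in> mideal V D2"
      by (auto simp: vec1_smult mideal_def)
    from f(2,3) D2 have "f \<in> mideal V D2"
      by (rule mvar_times_in_mideal)
    then show "j \<in> vec1 ` mideal V D2"
      by (simp add: f(1))
  qed (rule mvar_times_eq_zero)
  also have "{mvar v \<cdot>\<^sub>v j + k | j k :: ('a, 'k) mpoly vec.
      j \<in> vec1 ` mideal V D1 \<and> k \<in> vec1 ` mideal V D2} =
      {mvar v \<cdot>\<^sub>v vec1 f + vec1 g | f g. f \<in> mideal V D1 \<and> g \<in> mideal V D2}"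
    by blast
  also have "\<dots> = vec1 ` {mvar v * f + g | f g. f \<in> mideal V D1 \<and> g \<in> mideal V D2}"
    unfolding vec1_combination by blast
  also have "\<dots> = vec1 ` mideal V (insert v ` D1 \<union> D2)"
    by (simp only: mideal_splitting[OF \<open>v \<in> V\<close> D1])
  finally show ?thesis .
qed

section \<open>From stepwise linearity to an actual sequence of matrices\<close>

lemma homogeneous_mat_elements:
  assumes "homogeneous_mat V e n p A" "x \<in> elements_mat A"
  shows "x \<in> polynomials_in V \<and> homogeneous e x"
proof -
  obtain i j where ij: "i < dim_row A" "j < dim_col A" "x = A $$ (i, j)"
    using assms(2) by (metis elements_matD)
  then have "i < n" "j < p"
    using homogeneous_mat_carrier[OF assms(1)] by simp_all
  then show ?thesis
    unfolding ij(3) using assms(1) unfolding homogeneous_mat_def by blast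
qed

text \<open>Dependent choice unrolls the coinductive predicate: each matrix generates the syzygies
  of its predecessor, which is exactness.\<close>

lemma linear_resolutionI:
  fixes I :: "('a, 'k::field) mpoly set"
  assumes gen: "generated_in_degree V d I" and lin: "linear_module V d 1 (vec1 ` I)"
  shows "linear_resolution V d I"
proof -
  \<comment> \<open>The rank of the source is read off as \<open>dim_col A\<close>, so a single
    matrix can serve as the state of the recursion.\<close>
  define next_mat where "next_mat = (\<lambda>e n U (A :: ('a, 'k) mpoly mat).
    homogeneous_mat V e n (dim_col A) A \<and> U = (\<lambda>w. A *\<^sub>v w) ` free_module V (dim_col A) \<and>
    linear_module V 1 (dim_col A) (syzygies V A))"
  have next_mat_ex: "\<exists>A. next_mat e n U A" if U: "linear_module V e n U" for e n U
  proof -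
    obtain p A where A: "homogeneous_mat V e n p A" "U = (\<lambda>w. A *\<^sub>v w) ` free_module V p"
        "linear_module V 1 p (syzygies V A)"
      using U by (rule linear_moduleE)
    have "p = dim_col A" using homogeneous_mat_carrier[OF A(1)] by simp
    with A show ?thesis unfolding next_mat_def by blast
  qed
  have next_mat_lin: "linear_module V 1 (dim_col A) (syzygies V A)" if "next_mat e n U A" for e n U A
    using that by (simp add: next_mat_def)
  \<comment> \<open>The condition on the first matrix is tied to the index 0, so one application of
    dependent choice also fixes the beginning of the sequence.\<close>
  define start where "start i A \<longleftrightarrow> (i = 0 \<longrightarrow> next_mat d 1 (vec1 ` I) A) \<and>
    linear_module V 1 (dim_col A) (syzygies V A)" for i :: nat and A
  have "\<exists>M. \<forall>i. start i (M i) \<and> next_mat 1 (dim_col (M i)) (syzygies V (M i)) (M (Suc i))"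
  proof (rule dependent_nat_choice)
    show "\<exists>A. start 0 A"
      using next_mat_ex[OF lin] next_mat_lin unfolding start_def by blast
    show "\<exists>B. start (Suc i) B \<and> next_mat 1 (dim_col A) (syzygies V A) B" if A: "start i A" for A i
      using next_mat_ex[of 1 "dim_col A" "syzygies V A"] next_mat_lin A
      unfolding start_def by blast
  qed
  then obtain M where "\<And>i. start i (M i)"
      and M_Suc: "\<And>i. next_mat 1 (dim_col (M i)) (syzygies V (M i)) (M (Suc i))"
    by blast
  then have M0: "next_mat d 1 (vec1 ` I) (M 0)"
    by (simp add: start_def)
  \<comment> \<open>Generators start in degree \<open>d\<close> and each linear map raises the
    degree by one. Empty lists represent zero modules.\<close>
  define a where "a i = replicate (dim_col (M i)) (d + i)" for i
  have target: "target_degrees a 0 = [0]" "target_degrees a (Suc i) = a i" for i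
    by (simp_all add: target_degrees_def)
  have hom0: "homogeneous_mat V d 1 (dim_col (M 0)) (M 0)"
    and image0: "vec1 ` I = (\<lambda>w. M 0 *\<^sub>v w) ` free_module V (dim_col (M 0))"
    using M0 by (simp_all add: next_mat_def)
  have hom_Suc: "homogeneous_mat V 1 (dim_col (M i)) (dim_col (M (Suc i))) (M (Suc i))"
    and image_Suc: "syzygies V (M i) = (\<lambda>w. M (Suc i) *\<^sub>v w) ` free_module V (dim_col (M (Suc i)))" for i
    using M_Suc[of i] by (simp_all add: next_mat_def)
  have hom: "homogeneous_mat V (if i = 0 then d else 1) (length (target_degrees a i)) (length (a i)) (M i)" for i
    by (cases i) (use hom0 hom_Suc in \<open>auto simp: target a_def\<close>)
  have linear: "homogeneous 1 p" if "p \<in> elements_mat (M (Suc i))" for p i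
    using homogeneous_mat_elements[OF hom_Suc that] by blast
  have "{(M 0 *\<^sub>v w) $ 0 | w. w \<in> free_module V (length (a 0))} = I"
  proof -
    have "{(M 0 *\<^sub>v w) $ 0 | w. w \<in> free_module V (length (a 0))} = (\<lambda>w. w $ 0) ` vec1 ` I"
      unfolding image0 by (auto simp: a_def image_image)
    then show ?thesis by (simp add: image_image)
  qed
  moreover have "{w \<in> free_module V (length (a i)). M i *\<^sub>v w = 0\<^sub>v (length (target_degrees a i))} =
      (\<lambda>w. M (Suc i) *\<^sub>v w) ` free_module V (length (a (Suc i)))" for i
    using image_Suc[of i] syzygies_alt[OF homogeneous_mat_carrier[OF hom[of i]], of V]
    by (simp add: a_def)
  moreover have "elements_mat (M i) \<subseteq> polynomials_in V" for i
    using homogeneous_mat_elements[OF hom] by blast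
  moreover have "mon_degree m + target_degrees a i ! r = a i ! c"
    if "r < length (target_degrees a i)" "c < length (a i)" "m \<in> Poly_Mapping.keys (M i $$ (r, c))" for i r c m
  proof -
    have "homogeneous (if i = 0 then d else 1) (M i $$ (r, c))"
      using hom[of i] that(1,2) by (simp add: homogeneous_mat_def)
    then have "mon_degree m = (if i = 0 then d else 1)"
      using that(3) by (simp add: homogeneous_def)
    then show ?thesis
      using that(1,2) by (cases i) (auto simp: target a_def)
  qed
  moreover have "M i \<in> carrier_mat (length (target_degrees a i)) (length (a i))" for i
    by (rule homogeneous_mat_carrier[OF hom])
  ultimately have "graded_free_resolution V I a M"
    unfolding graded_free_resolution_def by blast
  \<comment> \<open>The constant monomial has degree 0, so it cannot occur in a linear form.\<close>
  moreover have "Poly_Mapping.lookup p 0 = 0" if "homogeneous 1 p" for p :: "('a, 'k) mpoly"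
    using that by (force simp: homogeneous_def in_keys_iff)
  ultimately have "minimal_graded_free_resolution V I a M"
    unfolding minimal_graded_free_resolution_def using linear by blast
  then show ?thesis
    unfolding linear_resolution_def using gen linear by blast
qed

section \<open>Chordal clutters\<close>

lemma minor_trans: "minor W D W' D' \<Longrightarrow> minor V C W D \<Longrightarrow> minor V C W' D'"
  by (induction rule: minor.induct) (auto intro: minor.intros)

lemma chordal_minor: "chordal V C \<Longrightarrow> minor V C W D \<Longrightarrow> chordal W D"
  unfolding chordal_def using minor_trans by blast

text \<open>Removing \<open>v\<close> leaves at least \<open>d\<close> elements in every circuit, so
  a set of size \<open>d\<close> obtained in this way is automatically minimal, and it must come
  from a circuit through \<open>v\<close>.\<close>

lemma in_contraction_iff:
  assumes C: "\<And>e. e \<in> C \<Longrightarrow> Suc d \<le> card e" and f: "v \<notin> f" "finite f" "card f = d"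
  shows "f \<in> contraction C v \<longleftrightarrow> insert v f \<in> C"
proof
  assume "f \<in> contraction C v"
  then obtain e where e: "e \<in> C" "f = e - {v}"
    by (auto simp: contraction_def minimal_sets_def)
  then have "v \<in> e" using C[of e] f by (metis Diff_insert_absorb Diff_empty Diff_insert0 Suc_n_not_le_n)
  with e show "insert v f \<in> C" by (simp add: insert_absorb)
next
  assume vf: "insert v f \<in> C"
  have "\<not> e - {v} \<subset> f" if "e \<in> C" for e
  proof
    assume "e - {v} \<subset> f"
    then have "card (e - {v}) < d"
      using psubset_card_mono[OF f(2)] f(3) by blast
    \<comment> \<open>Infinite sets have \<open>card\<close> 0, so the positive lower bound forces
      finiteness.\<close>
    moreover have "finite e"
      using C[OF that] by (auto intro: card_ge_0_finite)
    ultimately show False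
      using C[OF that] card_Suc_Diff1[of e v] by (cases "v \<in> e") auto
  qed
  moreover have "f = insert v f - {v}" using f by simp
  ultimately show "f \<in> contraction C v"
    unfolding contraction_def minimal_sets_def using vf by blast
qed

lemma card_contraction:
  assumes "\<And>e. e \<in> C \<Longrightarrow> Suc d \<le> card e" "f \<in> contraction C v"
  shows "d \<le> card f"
proof -
  obtain e where "e \<in> C" "f = e - {v}"
    using assms(2) by (auto simp: contraction_def minimal_sets_def)
  then show ?thesis
    using assms(1)[of e] card_Diff_singleton_if[of e v] by (auto split: if_splits)
qed

text \<open>Contractions of uniform clutters are not uniform, so the induction needs clutters with circuits
  of size at least \<open>d\<close>.  If \<open>v\<close> is simplicial and all \<open>insert v f\<close> for the
  \<open>d\<close>-subsets \<open>f\<close> of a set \<open>e\<close> of size \<open>Suc d\<close> are circuits, then so is \<open>e\<close>.  Hence the ideal of the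
  deletion lies in the ideal of the contraction.\<close>

lemma linear_module_complement_clutter:
  assumes "finite W" "W \<subseteq> V" "\<And>e. e \<in> C \<Longrightarrow> e \<subseteq> W" "\<And>e. e \<in> C \<Longrightarrow> d \<le> card e" "chordal W C"
  shows "linear_module V d 1
    (vec1 ` mideal V (complement_clutter d W C) :: ('a, 'k::comm_ring_1) mpoly vec set)"
  using assms
proof (induction W arbitrary: C d rule: finite_psubset_induct)
  case (psubset W C d)
  let ?lin = "\<lambda>d D. linear_module V d 1 (vec1 ` mideal V D :: ('a, 'k) mpoly vec set)"
  have empty: "?lin e {}" for e
  proof -
    have "mideal V {} = {0 :: ('a, 'k) mpoly}"
      by (auto simp: mideal_def)
    moreover have "vec1 0 = (0\<^sub>v 1 :: ('a, 'k) mpoly vec)"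
      by (intro eq_vecI) (auto simp: vec1_def)
    ultimately show ?thesis by (simp add: linear_module_zero)
  qed
  show ?case
  proof (cases d)
    case 0
    \<comment> \<open>The empty set is the only set of size 0, so the ideal is either zero or the
      whole ring.\<close>
    have "mideal V {{}} = (polynomials_in V :: ('a, 'k) mpoly set)"
      by (auto simp: mideal_def)
    then have "?lin 0 {{}}"
      using linear_module_free[of V 1] by (simp add: vec1_image_polynomials_in)
    moreover have "card e = 0 \<longleftrightarrow> e = {}" if "e \<subseteq> W" for e
      using finite_subset[OF that \<open>finite W\<close>] by simp
    then have "complement_clutter 0 W C = (if {} \<in> C then {} else {{}})"
      by (auto simp: complement_clutter_def)
    ultimately show ?thesis using 0 empty by simp
  next
    case d: (Suc d')
    show ?thesis
    proof (cases "W = {}")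
      case True
      then have "complement_clutter d W C = {}"
        using d by (auto simp: complement_clutter_def)
      then show ?thesis by (simp only: empty)
    next
      case False
      then obtain v where v: "simplicial_vertex W C v"
        using \<open>chordal W C\<close> minor_refl unfolding chordal_def by blast
      then have "v \<in> W" by (simp add: simplicial_vertex_def)
      then have W': "W - {v} \<subset> W" "W - {v} \<subseteq> V" and "v \<in> V" using psubset.prems(1) by auto
      have C: "\<And>e. e \<in> C \<Longrightarrow> Suc d' \<le> card e" using psubset.prems(3) d by simp
      have fin: "finite e" if "e \<subseteq> W" for e using that \<open>finite W\<close> by (rule finite_subset)
      let ?D1 = "complement_clutter d' (W - {v}) (contraction C v)"
      let ?D2 = "complement_clutter (Suc d') (W - {v}) (deletion C v)"
      have "f \<in> contraction C v \<longleftrightarrow> insert v f \<in> C" if "f \<subseteq> W - {v}" "card f = d'" for f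
      proof (rule in_contraction_iff)
        show "finite f" using fin that(1) by blast
      qed (use that C in auto)
      then have D1: "?D1 = {f. f \<subseteq> W - {v} \<and> card f = d' \<and> insert v f \<notin> C}"
        unfolding complement_clutter_def by auto
      have D2: "?D2 = {e. e \<subseteq> W - {v} \<and> card e = Suc d' \<and> e \<notin> C}"
        by (auto simp: complement_clutter_def deletion_def)
      \<comment> \<open>Missing sets through \<open>v\<close> correspond to missing sets of the
        contraction, one size smaller; those avoiding \<open>v\<close> are the missing sets of the
        deletion.\<close>
      have D: "complement_clutter d W C = insert v ` ?D1 \<union> ?D2" (is "?L = ?R")
      proof
        show "?L \<subseteq> ?R"
        proof
          fix e assume "e \<in> ?L"
          then have e: "e \<subseteq> W" "card e = Suc d'" "e \<notin> C"
            by (auto simp: complement_clutter_def d)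
          show "e \<in> ?R"
          proof (cases "v \<in> e")
            case True
            then have "e = insert v (e - {v})" "e - {v} \<in> ?D1"
              using e unfolding D1 by (auto simp: insert_absorb)
            then show ?thesis by blast
          next
            case False
            then show ?thesis using e unfolding D2 by blast
          qed
        qed
        show "?R \<subseteq> ?L"
        proof
          fix e assume "e \<in> ?R"
          then consider f where "e = insert v f" "f \<in> ?D1" | "e \<in> ?D2" by blast
          then show "e \<in> ?L"
          proof cases
            case 1
            then have "f \<subseteq> W - {v}" "card f = d'" "insert v f \<notin> C" unfolding D1 by auto
            moreover from this have "finite f" "v \<notin> f" using fin by blast+
            ultimately show ?thesis
              using 1(1) \<open>v \<in> W\<close> by (auto simp: complement_clutter_def d)
          next
            case 2
            then show ?thesis unfolding D2 by (auto simp: complement_clutter_def d)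
          qed
        qed
      qed
      have K: "?lin (Suc d') ?D2"
      proof (rule psubset.IH[OF W'])
        show "chordal (W - {v}) (deletion C v)"
          using psubset.prems(4) by (rule chordal_minor) (intro minor_deletion minor_refl \<open>v \<in> W\<close>)
      qed (use psubset.prems(2) C in \<open>auto simp: deletion_def\<close>)
      have J: "?lin d' ?D1"
      proof (rule psubset.IH[OF W'])
        show "chordal (W - {v}) (contraction C v)"
          using psubset.prems(4) by (rule chordal_minor) (intro minor_contraction minor_refl \<open>v \<in> W\<close>)
        show "f \<subseteq> W - {v}" if "f \<in> contraction C v" for f
          using that psubset.prems(2) by (auto simp: contraction_def minimal_sets_def)
        show "d' \<le> card f" if "f \<in> contraction C v" for f
          using C that by (rule card_contraction)
      qed
      show ?thesis
      \<comment> \<open>If {v} is a circuit and \<open>d'\<close> is 0, nothing is missing from the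
        contraction: J is zero and the ideal is just K.\<close>
      proof (cases "d' = 0 \<and> {v} \<in> C")
        case True
        have "insert v f \<in> C" if "f \<subseteq> W - {v}" "card f = d'" for f
        proof -
          have "finite f" using that(1) fin by blast
          then show ?thesis using that(2) True by simp
        qed
        then have "?D1 = {}" unfolding D1 by blast
        then show ?thesis using K D d by simp
      next
        case False
        have "\<exists>f\<in>?D1. f \<subseteq> e" if "e \<in> ?D2" for e
        proof (rule ccontr)
          assume "\<not> (\<exists>f\<in>?D1. f \<subseteq> e)"
          moreover have e: "e \<subseteq> W - {v}" "card e = Suc d'" "e \<notin> C"
            using that unfolding D2 by auto
          ultimately have ins: "insert v f \<in> C" if "f \<subseteq> e" "card f = d'" for f
            using that unfolding D1 by blast
          have "finite e" using e fin by blast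
          \<comment> \<open>For \<open>d'\<close> = 0 the empty subset of \<open>e\<close> would
            make {v} a circuit, which is the excluded case.\<close>
          have "d' \<noteq> 0"
            using False ins[of "{}"] by auto
          \<comment> \<open>Two distinct points of \<open>e\<close> give two distinct circuits
            through \<open>v\<close>, whose union without \<open>v\<close> is exactly
            \<open>e\<close>.\<close>
          then obtain x y where xy: "x \<in> e" "y \<in> e" "x \<noteq> y"
            using e(2) card_le_Suc0_iff_eq[OF \<open>finite e\<close>] by auto
          let ?e1 = "insert v (e - {x})" and ?e2 = "insert v (e - {y})"
          have "?e1 \<in> C" "?e2 \<in> C"
            using ins[of "e - {x}"] ins[of "e - {y}"] xy e(2) by auto
          moreover have "?e1 \<noteq> ?e2" using xy e(1) by blast
          ultimately obtain e3 where e3: "e3 \<in> C" "e3 \<subseteq> (?e1 \<union> ?e2) - {v}"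
            using v unfolding simplicial_vertex_def by blast
          then have "e3 \<subseteq> e" by blast
          \<comment> \<open>The lower bound on circuit sizes replaces uniformity: \<open>e3\<close>
            is a subset of \<open>e\<close> with at least as many elements.\<close>
          then have "e3 = e"
            using card_seteq[OF \<open>finite e\<close>] C[OF e3(1)] e(2) by simp
          with e3(1) e(3) show False by simp
        qed
        then show ?thesis
          unfolding D unfolding d
          by (intro linear_module_mideal_splitting \<open>v \<in> V\<close> J K) (auto simp: D1 D2)
      qed
    qed
  qed
qed

theorem theorem1p2:
  fixes V :: "'a set" and C :: "'a set set" and d :: nat
  assumes "clutter V C"
    and "uniform d C"
    and "chordal V C"
  shows "linear_resolution V d
    (circuit_ideal V (complement_clutter d V C) :: ('a, 'k::field) mpoly set)"
proof -
  have V: "finite V" "\<And>e. e \<in> C \<Longrightarrow> e \<subseteq> V" and d: "\<And>e. e \<in> C \<Longrightarrow> d \<le> card e"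
    using assms(1,2) by (auto simp: clutter_def uniform_def)
  have D: "finite e \<and> e \<subseteq> V \<and> card e = d" if "e \<in> complement_clutter d V C" for e
    using that V(1) by (auto simp: complement_clutter_def finite_subset)
  then have "circuit_ideal V (complement_clutter d V C) =
      (mideal V (complement_clutter d V C) :: ('a, 'k) mpoly set)"
    by (intro circuit_ideal_eq_mideal) blast
  moreover have "linear_module V d 1
      (vec1 ` mideal V (complement_clutter d V C) :: ('a, 'k) mpoly vec set)"
    using V d assms(3) by (intro linear_module_complement_clutter) auto
  moreover have "generated_in_degree V d
      (circuit_ideal V (complement_clutter d V C) :: ('a, 'k) mpoly set)"
    using D by (rule generated_in_degree_circuit_ideal)
  ultimately show ?thesis
    by (simp add: linear_resolutionI)
qed

end
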